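(* Consider the networked dynamical system $$\dot{\mathbf{x}}(t)=(I_N\otimes A+\mathbf{G}\otimes bc^T)\mathbf{x}(t)+(I_N\otimes b)\mathbf{w}(t),\qquad \mathbf{y}(t)=(I_N\otimes c^T)\mathbf{x}(t),$$ where $A\in\mathbb{R}^{n\times n}$, $b,c\in\mathbb{R}^n$, the connectivity matrix $\mathbf{G}=[g_{ij}]\in\mathbb{R}^{N\times N}$ satisfies $\mathbf{G}\ge0$ (entrywise nonnegativity) and $\mathrm{Tr}(\mathbf{G}^2)=0$ (nonreciprocity), and $I_N\otimes A+\mathbf{G}\otimes bc^T$ is Hurwitz. Assume the inputs $w_1,\dots,w_N$ are uncorrelated zero-mean wide-sense stationary processes with identical autocorrelation function, hence common power spectral density $S_w(\omega)$, and that $S_w(\omega)>0$ for all $\omega\in(-\Omega,\Omega)$, where $\Omega>0$. Let $\mathbf{S}(\omega)=[S_{y_iy_j}(\omega)]$ be the $N\times N$ matrix of output cross-power spectral densities and $h(\mathrm{j}\omega)=c^T(\mathrm{j}\omega I_n-A)^{-1}b$ the nodal transfer function. Then, for $\omega\in(-\Omega,\Omega)$, $$g_{ij}=\max\left\{S_w(\omega)\left(\frac{[\mathrm{Im}\{\mathbf{S}^{-1}(\omega)\}]_{ij}}{\mathrm{Im}\{h^{-1}(\mathrm{j}\omega)\}}\right),\,0\right\}\qquad\text{for } 1\le i\neq j\le N.$$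
   Context: $\mathrm{j}$ (upright) is the imaginary unit; $\otimes$ is the Kronecker product; $I_d$ is the $d\times d$ identity matrix; $h^{-1}=1/h$; the imaginary part of a matrix is taken entrywise. $\mathbf{x}(t)\in\mathbb{R}^{Nn}$ is the network state, $\mathbf{w}(t)=(w_1(t),\dots,w_N(t))^T$ the input noise vector, and $\mathbf{y}(t)=(y_1(t),\dots,y_N(t))^T$ the output vector, all real stochastic processes. The cross-correlation is $R_{xy}(\tau)=\mathbb{E}(x(t)y(t-\tau))$, the cross-power spectral density $S_{xy}(\omega)$ is its Fourier transform, and the power spectral density is $S_x=S_{xx}$.
   Formalization: The formula is stated for those ω in (−Ω,Ω) where jωI−A is invertible and Im{1/h(jω)} ≠ 0 (it is undefined at ω = 0, where h is real); the outputs are taken jointly wide-sense stationary and w jointly measurable, so that S(ω) and the noise integrals make sense. *)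

theory Defs
  imports "HOL-Probability.Probability"
begin

subsection \<open>Kronecker products and Hurwitz matrices\<close>

text \<open>Row \<open>(i, k)\<close> of a Kronecker product is row \<open>k\<close> of block row \<open>i\<close>, and likewise for columns.\<close>

definition kron :: "real^'q^'p \<Rightarrow> real^'s^'r \<Rightarrow> real^('q \<times> 's)^('p \<times> 'r)" where
  "kron P Q = (\<chi> i j. P $ fst i $ fst j * Q $ snd i $ snd j)"

text \<open>Kronecker products with a column \<open>v\<close> and with a row \<open>v\<^sup>T\<close>; the index set \<open>'q \<times> 1\<close>
  (respectively \<open>'p \<times> 1\<close>) is identified with \<open>'q\<close> (respectively \<open>'p\<close>), as
  the two lemmas below make explicit.\<close>

definition kron_col :: "real^'q^'p \<Rightarrow> real^'r \<Rightarrow> real^'q^('p \<times> 'r)" where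
  "kron_col P v = (\<chi> i j. P $ fst i $ j * v $ snd i)"

definition kron_row :: "real^'q^'p \<Rightarrow> real^'s \<Rightarrow> real^('q \<times> 's)^'p" where
  "kron_row P v = (\<chi> i j. P $ i $ fst j * v $ snd j)"

lemma kron_col_eq_kron: "kron_col P v $ i $ j = kron P (columnvector v :: real^1^'r) $ i $ (j, 1)"
  for P :: "real^'q^'p" and v :: "real^'r"
  by (simp add: kron_col_def kron_def columnvector_def)

lemma kron_row_eq_kron: "kron_row P v $ i $ j = kron P (rowvector v :: real^'s^1) $ (i, 1) $ j"
  for P :: "real^'q^'p" and v :: "real^'s"
  by (simp add: kron_row_def kron_def rowvector_def)

definition hurwitz :: "real^'k^'k \<Rightarrow> bool" where
  "hurwitz M \<longleftrightarrow> (\<forall>\<mu> v. v \<noteq> 0 \<and> map_matrix complex_of_real M *v v = \<mu> *s v \<longrightarrow> Re \<mu> < 0)"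

subsection \<open>The networked system\<close>

definition system_matrix ::
    "real^'n^'n \<Rightarrow> real^'n \<Rightarrow> real^'n \<Rightarrow> real^'m^'m \<Rightarrow> real^('m \<times> 'n)^('m \<times> 'n)" where
  "system_matrix A b c G = kron (mat 1) A + kron G (columnvector b ** (rowvector c :: real^'n^1))"

text \<open>The differential equation is understood pathwise, almost surely, and in integrated
  (Caratheodory) form, so that the noise paths may be discontinuous. The integral is the gauge
  integral, for which an everywhere differentiable path is the integral of its derivative without
  further conditions; hence classical solutions are covered. The time axis is the whole
  real line.\<close>

definition network_solution ::
    "'a measure \<Rightarrow> real^'n^'n \<Rightarrow> real^'n \<Rightarrow> real^'n \<Rightarrow> real^'m^'m \<Rightarrow>
     (real \<Rightarrow> 'a \<Rightarrow> real^'m) \<Rightarrow> (real \<Rightarrow> 'a \<Rightarrow> real^('m \<times> 'n)) \<Rightarrow> (real \<Rightarrow> 'a \<Rightarrow> real^'m) \<Rightarrow> bool" where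
  "network_solution P A b c G w x y \<longleftrightarrow>
     (AE p in P.
        (\<forall>s t. s \<le> t \<longrightarrow>
           ((\<lambda>u. system_matrix A b c G *v x u p + kron_col (mat 1) b *v w u p)
              has_integral (x t p - x s p)) {s..t}) \<and>
        (\<forall>t. y t p = kron_row (mat 1) c *v x t p))"

text \<open>Meaningful only where \<open>s\<close> is not an eigenvalue of \<open>A\<close>. At \<open>s = 0\<close> the value is real, so
  quotients by the imaginary part of its reciprocal are undefined at frequency \<open>0\<close>.\<close>

definition nodal_transfer :: "real^'n^'n \<Rightarrow> real^'n \<Rightarrow> real^'n \<Rightarrow> complex \<Rightarrow> complex" where
  "nodal_transfer A b c s =
     (\<Sum>i\<in>UNIV. complex_of_real (c $ i) *
        (matrix_inv (mat s - map_matrix complex_of_real A) *v (\<chi> k. complex_of_real (b $ k))) $ i)"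

subsection \<open>Second-order stationary processes\<close>

text \<open>\<open>R\<^sub>X\<^sub>Y(\<tau>) = E(X(t) Y(t - \<tau>))\<close>, written at the reference time \<open>t = 0\<close>; it is used
  for jointly wide-sense stationary processes only, where the choice of \<open>t\<close> is immaterial.\<close>

definition cross_correlation ::
    "'a measure \<Rightarrow> (real \<Rightarrow> 'a \<Rightarrow> real) \<Rightarrow> (real \<Rightarrow> 'a \<Rightarrow> real) \<Rightarrow> real \<Rightarrow> real" where
  "cross_correlation P X Y \<tau> = (\<integral>p. X 0 p * Y (0 - \<tau>) p \<partial>P)"

definition second_order_process :: "'a measure \<Rightarrow> (real \<Rightarrow> 'a \<Rightarrow> real) \<Rightarrow> bool" where
  "second_order_process P X \<longleftrightarrow>
     (\<forall>t. X t \<in> borel_measurable P \<and> integrable P (\<lambda>p. (X t p)\<^sup>2))"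

definition wide_sense_stationary :: "'a measure \<Rightarrow> (real \<Rightarrow> 'a \<Rightarrow> real) \<Rightarrow> bool" where
  "wide_sense_stationary P X \<longleftrightarrow>
     second_order_process P X \<and>
     (\<forall>t. (\<integral>p. X t p \<partial>P) = (\<integral>p. X 0 p \<partial>P)) \<and>
     (\<forall>t \<tau>. (\<integral>p. X t p * X (t - \<tau>) p \<partial>P) = cross_correlation P X X \<tau>)"

definition jointly_wide_sense_stationary ::
    "'a measure \<Rightarrow> (real \<Rightarrow> 'a \<Rightarrow> real) \<Rightarrow> (real \<Rightarrow> 'a \<Rightarrow> real) \<Rightarrow> bool" where
  "jointly_wide_sense_stationary P X Y \<longleftrightarrow>
     wide_sense_stationary P X \<and> wide_sense_stationary P Y \<and>
     (\<forall>t \<tau>. (\<integral>p. X t p * Y (t - \<tau>) p \<partial>P) = cross_correlation P X Y \<tau>)"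

definition uncorrelated_processes ::
    "'a measure \<Rightarrow> (real \<Rightarrow> 'a \<Rightarrow> real) \<Rightarrow> (real \<Rightarrow> 'a \<Rightarrow> real) \<Rightarrow> bool" where
  "uncorrelated_processes P X Y \<longleftrightarrow>
     (\<forall>s t. (\<integral>p. X s p * Y t p \<partial>P) = (\<integral>p. X s p \<partial>P) * (\<integral>p. Y t p \<partial>P))"

text \<open>The gauge integral over the real line includes conditionally convergent (improper) Fourier
  integrals, such as that of the \<open>sinc\<close> autocorrelation of band-limited noise. It
  is \<open>0\<close> where the Fourier integral does not exist, so a nonzero value entails existence.\<close>

definition fourier_transform :: "(real \<Rightarrow> real) \<Rightarrow> real \<Rightarrow> complex" where
  "fourier_transform R \<omega> =
     integral UNIV (\<lambda>\<tau>. complex_of_real (R \<tau>) * exp (- (\<i> * complex_of_real \<omega> * complex_of_real \<tau>)))"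

definition cross_psd ::
    "'a measure \<Rightarrow> (real \<Rightarrow> 'a \<Rightarrow> real) \<Rightarrow> (real \<Rightarrow> 'a \<Rightarrow> real) \<Rightarrow> real \<Rightarrow> complex" where
  "cross_psd P X Y \<omega> = fourier_transform (cross_correlation P X Y) \<omega>"

definition cross_psd_matrix ::
    "'a measure \<Rightarrow> (real \<Rightarrow> 'a \<Rightarrow> real^'m) \<Rightarrow> real \<Rightarrow> complex^'m^'m" where
  "cross_psd_matrix P y \<omega> = (\<chi> i j. cross_psd P (\<lambda>t p. y t p $ i) (\<lambda>t p. y t p $ j) \<omega>)"

end

theory Submission
  imports Defs "HOL-Computational_Algebra.Fundamental_Theorem_Algebra"
begin

text \<open>Write \<open>M\<close> for the system matrix, \<open>B\<close> and \<open>C\<close> for the input and output matrices. Since \<open>M\<close> is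
  Hurwitz and the outputs are stationary, the outputs are almost surely the inputs filtered by the
  exponentially decaying impulse response \<open>C exp(M u) B\<close>. Hence \<open>S = S\<^sub>w H H\<^sup>*\<close>, where the frequency
  response \<open>H\<close> satisfies \<open>(h\<^sup>-\<^sup>1 I - G) H = I\<close>, so that
  \<open>S\<^sub>w S\<^sup>-\<^sup>1 = (h\<^sup>-\<^sup>1 I - G)\<^sup>* (h\<^sup>-\<^sup>1 I - G)\<close>. Off the diagonal, the imaginary part of the right-hand
  side is \<open>Im(h\<^sup>-\<^sup>1) (G - G\<^sup>T)\<close>, and nonreciprocity says that for \<open>i \<noteq> j\<close> at most one of \<open>g\<^sub>i\<^sub>j\<close>,
  \<open>g\<^sub>j\<^sub>i\<close> is nonzero.\<close>

subsection \<open>The matrix exponential of a Hurwitz matrix\<close>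

text \<open>Three weak hypotheses shape the proof. The state is merely measurable, so decay of
  \<open>mexp M T\<close> alone does not make the remote past negligible in mean square: second
  moments of the stationary outputs must first be transferred to those functionals of the state that
  the output sees. Noise paths may be discontinuous, so integration by parts is done for indefinite
  integrals, by Fubini. The noise autocorrelation need not be absolutely integrable, so the
  convolution theorem is obtained on finite windows and then passed to the limit. The matrix
  \<open>A\<close> may itself be unstable; only its resolvent at the given frequency enters. With
  \<open>q = 1/h\<close>, the factor \<open>q I - G\<close> comes from
  \<open>H = h (I + G H)\<close>. In its Gram product \<open>G\<^sup>T G\<close> is real and
  \<open>|q|\<^sup>2 I\<close> is diagonal, so only the cross terms
  \<open>- cnj q G - q G\<^sup>T\<close> have an off-diagonal imaginary part.\<close>

definition mpow :: "real^'k^'k \<Rightarrow> nat \<Rightarrow> real^'k^'k" where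
  "mpow M n = ((**) M ^^ n) (mat 1)"

lemma mpow_0 [simp]: "mpow M 0 = mat 1"
  by (simp add: mpow_def)

lemma mpow_Suc: "mpow M (Suc n) = M ** mpow M n"
  by (simp add: mpow_def)

lemma mpow_Suc': "mpow M (Suc n) = mpow M n ** M"
  by (induction n) (simp_all add: mpow_Suc matrix_mul_assoc)

text \<open>The sum of all absolute entries dominates every absolute row sum, so each further factor
  \<open>M\<close> costs at most one more power of it. This compares the entries of the exponential
  series with a scalar one.\<close>

lemma abs_mpow_le: "\<bar>mpow M n $ i $ j\<bar> \<le> (\<Sum>k\<in>UNIV. \<Sum>l\<in>UNIV. \<bar>M $ k $ l\<bar>) ^ n"
proof (induction n arbitrary: i j)
  case 0
  show ?case by (simp add: mat_def)
next
  case (Suc n)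
  let ?K = "\<Sum>k\<in>UNIV. \<Sum>l\<in>UNIV. \<bar>M $ k $ l\<bar>"
  have "\<bar>mpow M (Suc n) $ i $ j\<bar> = \<bar>\<Sum>l\<in>UNIV. M $ i $ l * mpow M n $ l $ j\<bar>"
    by (simp add: mpow_Suc matrix_matrix_mult_def)
  also have "\<dots> \<le> (\<Sum>l\<in>UNIV. \<bar>M $ i $ l\<bar> * ?K ^ n)"
    by (rule order_trans[OF sum_abs]) (intro sum_mono, simp add: abs_mult mult_left_mono Suc.IH)
  also have "\<dots> = (\<Sum>l\<in>UNIV. \<bar>M $ i $ l\<bar>) * ?K ^ n"
    by (simp add: sum_distrib_right)
  also have "\<dots> \<le> ?K * ?K ^ n"
    by (intro mult_right_mono member_le_sum zero_le_power sum_nonneg) auto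
  finally show ?case by simp
qed

text \<open>Given entry by entry, so that convergence and termwise differentiation are those of real
  power series.\<close>

definition mexp :: "real^'k^'k \<Rightarrow> real \<Rightarrow> real^'k^'k" where
  "mexp M t = (\<chi> i j. \<Sum>n. mpow M n $ i $ j / fact n * t ^ n)"

lemma summable_mexp: "summable (\<lambda>n. mpow M n $ i $ j / fact n * t ^ n)"
proof (rule summable_comparison_test)
  let ?K = "\<Sum>k\<in>UNIV. \<Sum>l\<in>UNIV. \<bar>M $ k $ l\<bar>"
  show "summable (\<lambda>n. inverse (fact n) * (?K * \<bar>t\<bar>) ^ n)"
    by (rule summable_exp)
  have "norm (mpow M n $ i $ j / fact n * t ^ n) \<le> inverse (fact n) * (?K * \<bar>t\<bar>) ^ n" for n
    using mult_right_mono[OF abs_mpow_le[of M n i j], of "inverse (fact n) * \<bar>t\<bar> ^ n"]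
    by (simp add: abs_mult power_abs power_mult_distrib field_simps)
  then show "\<exists>N. \<forall>n\<ge>N. norm (mpow M n $ i $ j / fact n * t ^ n) \<le> inverse (fact n) * (?K * \<bar>t\<bar>) ^ n"
    by blast
qed

lemma mexp_0 [simp]: "mexp M 0 = mat 1"
  by (simp add: mexp_def vec_eq_iff powser_zero del: times_divide_eq_left)

lemma mexp_deriv_suminf:
  "((\<lambda>t. mexp M t $ i $ j) has_real_derivative (\<Sum>n. mpow M (Suc n) $ i $ j / fact n * t ^ n)) (at t)"
proof -
  let ?c = "\<lambda>n. mpow M n $ i $ j / fact n"
  have "((\<lambda>t. \<Sum>n. ?c n * t ^ n) has_real_derivative (\<Sum>n. diffs ?c n * t ^ n)) (at t)"
    by (rule termdiffs_strong_converges_everywhere) (rule summable_mexp)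
  moreover have "diffs ?c = (\<lambda>n. mpow M (Suc n) $ i $ j / fact n)"
    by (auto simp: diffs_def fun_eq_iff field_simps simp del: of_nat_Suc)
  ultimately show ?thesis by (simp add: mexp_def)
qed

text \<open>Both orders of the product are needed: \<open>M ** mexp M t\<close> for the resolvent
  identity, \<open>mexp M t ** M\<close> for decay and for variation of constants. They come from
  the two recursions of \<open>mpow\<close>.\<close>

lemma mexp_deriv_left:
  "((\<lambda>t. mexp M t $ i $ j) has_real_derivative (M ** mexp M t) $ i $ j) (at t)"
proof -
  have "(\<Sum>n. mpow M (Suc n) $ i $ j / fact n * t ^ n)
      = (\<Sum>n. \<Sum>l\<in>UNIV. M $ i $ l * (mpow M n $ l $ j / fact n * t ^ n))"
    by (simp add: mpow_Suc matrix_matrix_mult_def sum_distrib_right sum_divide_distrib mult.assoc)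
  also have "\<dots> = (\<Sum>l\<in>UNIV. \<Sum>n. M $ i $ l * (mpow M n $ l $ j / fact n * t ^ n))"
    by (rule suminf_sum) (intro summable_mult summable_mexp)
  also have "\<dots> = (M ** mexp M t) $ i $ j"
    by (simp add: matrix_matrix_mult_def mexp_def suminf_mult summable_mexp del: times_divide_eq_left times_divide_eq_right)
  finally show ?thesis using mexp_deriv_suminf[of M i j t] by simp
qed

lemma mexp_deriv_right:
  "((\<lambda>t. mexp M t $ i $ j) has_real_derivative (mexp M t ** M) $ i $ j) (at t)"
proof -
  have "(\<Sum>n. mpow M (Suc n) $ i $ j / fact n * t ^ n)
      = (\<Sum>n. \<Sum>l\<in>UNIV. (mpow M n $ i $ l / fact n * t ^ n) * M $ l $ j)"
    by (simp add: mpow_Suc' matrix_matrix_mult_def sum_distrib_left sum_distrib_right sum_divide_distrib mult_ac)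
  also have "\<dots> = (\<Sum>l\<in>UNIV. \<Sum>n. (mpow M n $ i $ l / fact n * t ^ n) * M $ l $ j)"
    by (rule suminf_sum) (intro summable_mult2 summable_mexp)
  also have "\<dots> = (mexp M t ** M) $ i $ j"
    by (simp add: matrix_matrix_mult_def mexp_def suminf_mult2 summable_mexp del: times_divide_eq_left times_divide_eq_right)
  finally show ?thesis using mexp_deriv_suminf[of M i j t] by simp
qed

lemma continuous_on_mexp [continuous_intros]: "continuous_on S (\<lambda>t. mexp M t $ i $ j)"
  by (rule continuous_at_imp_continuous_on) (auto intro: DERIV_isCont mexp_deriv_left)

lemma borel_measurable_mexp [measurable]: "(\<lambda>t. mexp M t $ i $ j) \<in> borel_measurable borel"
  by (intro borel_measurable_continuous_onI continuous_on_mexp)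


section \<open>Scalar linear equations with decaying forcing\<close>

definition exp_decay :: "(real \<Rightarrow> complex) \<Rightarrow> bool" where
  "exp_decay f \<longleftrightarrow> (\<exists>K \<alpha>. \<alpha> > 0 \<and> (\<forall>t\<ge>0. norm (f t) \<le> K * exp (- (\<alpha> * t))))"

text \<open>The integrating factor \<open>exp (- \<mu> t)\<close> removes the homogeneous part,
  leaving only the integral of the forcing to be estimated.\<close>

lemma exp_decay_ode:
  fixes f g :: "real \<Rightarrow> complex"
  assumes deriv: "\<And>t. (f has_vector_derivative \<mu> * f t + g t) (at t)"
    and g: "exp_decay g" and "Re \<mu> < 0"
  shows "exp_decay f"
proof -
  obtain K \<alpha> where "\<alpha> > 0" and K: "\<And>t. t \<ge> 0 \<Longrightarrow> norm (g t) \<le> K * exp (- (\<alpha> * t))"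
    using g unfolding exp_decay_def by blast
  \<comment> \<open>If the forcing decayed at exactly the rate \<open>- Re \<mu>\<close>, resonance
    would add a factor \<open>t\<close>. Giving up half of that rate keeps \<open>\<delta>\<close>
    strictly positive.\<close>
  define \<beta> where "\<beta> = min \<alpha> (- Re \<mu> / 2)"
  define \<delta> where "\<delta> = - Re \<mu> - \<beta>"
  have "\<beta> > 0" "\<delta> > 0" "\<beta> \<le> \<alpha>" using \<open>\<alpha> > 0\<close> \<open>Re \<mu> < 0\<close> by (auto simp: \<beta>_def \<delta>_def min_def)
  have "K \<ge> 0" using order_trans[OF norm_ge_zero K[of 0]] by simp
  have g_le: "norm (g t) \<le> K * exp (- (\<beta> * t))" if "t \<ge> 0" for t
    using that \<open>\<beta> \<le> \<alpha>\<close> \<open>K \<ge> 0\<close> K[OF that]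
    by (intro order_trans[OF K[OF that]] mult_left_mono) (auto simp: mult_right_mono)
  define h where "h t = exp (- (\<mu> * of_real t)) * f t" for t
  have h_deriv: "(h has_vector_derivative exp (- (\<mu> * of_real t)) * g t) (at t)" for t
  proof -
    have "((\<lambda>t. exp (- (\<mu> * of_real t))) has_vector_derivative exp (- (\<mu> * of_real t)) * (- \<mu>)) (at t)"
      by (rule has_vector_derivative_real_field) (auto intro!: derivative_eq_intros)
    from has_vector_derivative_mult[OF this deriv[of t]] show ?thesis
      by (simp add: h_def[abs_def] algebra_simps)
  qed
  have bound: "norm (f t) \<le> (norm (f 0) + K / \<delta>) * exp (- (\<beta> * t))" if "t > 0" for t
  proof -
    have exp_norm: "norm (exp (- (\<mu> * of_real s))) = exp (- (Re \<mu> * s))" for s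
      by (simp add: norm_exp_eq_Re)
    \<comment> \<open>Mean value inequality with the majorant
      \<open>K / \<delta> * exp (\<delta> * t)\<close>, whose derivative bounds the norm of the
      derivative of \<open>h\<close>.\<close>
    have "norm (h t - h 0) \<le> K / \<delta> * exp (\<delta> * t) - K / \<delta> * exp (\<delta> * 0)"
    proof (rule differentiable_bound_general[OF \<open>0 < t\<close>])
      show "continuous_on {0..t} h"
        by (rule continuous_at_imp_continuous_on)
          (auto intro: has_vector_derivative_continuous h_deriv)
      show "continuous_on {0..t} (\<lambda>t. K / \<delta> * exp (\<delta> * t))"
        by (intro continuous_intros)
      show "(h has_vector_derivative exp (- (\<mu> * of_real s)) * g s) (at s)" for s
        by (rule h_deriv)
      show "((\<lambda>t. K / \<delta> * exp (\<delta> * t)) has_vector_derivative K * exp (\<delta> * s)) (at s)" for s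
        using \<open>\<delta> > 0\<close>
        by (auto intro!: derivative_eq_intros simp: has_real_derivative_iff_has_vector_derivative[symmetric])
      show "norm (exp (- (\<mu> * of_real s)) * g s) \<le> K * exp (\<delta> * s)" if "0 < s" for s
      proof -
        have "norm (exp (- (\<mu> * of_real s)) * g s) \<le> exp (- (Re \<mu> * s)) * (K * exp (- (\<beta> * s)))"
          using g_le[of s] that by (simp add: norm_mult exp_norm)
        also have "\<dots> = K * exp (\<delta> * s)"
          by (simp add: \<delta>_def exp_add[symmetric] algebra_simps)
        finally show ?thesis .
      qed
    qed
    then have "norm (h t) \<le> norm (f 0) + K / \<delta> * exp (\<delta> * t)"
      using norm_triangle_ineq[of "h t - h 0" "h 0"] divide_nonneg_pos[OF \<open>K \<ge> 0\<close> \<open>\<delta> > 0\<close>]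
      by (simp add: h_def del: times_divide_eq_left)
    also have "\<dots> \<le> (norm (f 0) + K / \<delta>) * exp (\<delta> * t)"
      using \<open>\<delta> > 0\<close> \<open>t > 0\<close> mult_left_mono[of 1 "exp (\<delta> * t)" "norm (f 0)"]
      by (simp add: algebra_simps)
    finally have "norm (h t) * exp (Re \<mu> * t) \<le> (norm (f 0) + K / \<delta>) * exp (\<delta> * t) * exp (Re \<mu> * t)"
      by (rule mult_right_mono) simp
    moreover have "norm (h t) * exp (Re \<mu> * t) = norm (f t)"
      unfolding h_def norm_mult exp_norm by (simp add: exp_minus)
    moreover have "exp (\<delta> * t) * exp (Re \<mu> * t) = exp (- (\<beta> * t))"
      by (simp add: \<delta>_def exp_add[symmetric] algebra_simps)
    ultimately show ?thesis by (simp add: mult.assoc)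
  qed
  have "norm (f t) \<le> (norm (f 0) + K / \<delta>) * exp (- (\<beta> * t))" if "t \<ge> 0" for t
    using that bound[of t] \<open>K \<ge> 0\<close> \<open>\<delta> > 0\<close> by (cases "t = 0") auto
  with \<open>\<beta> > 0\<close> show ?thesis unfolding exp_decay_def by blast
qed

section \<open>Polynomials in a matrix, applied to a vector\<close>

definition poly_apply :: "complex poly \<Rightarrow> complex^'k^'k \<Rightarrow> complex^'k \<Rightarrow> complex^'k" where
  "poly_apply p T v = (\<Sum>i\<le>degree p. coeff p i *s (((*v) T ^^ i) v))"

lemma poly_apply_eq_sum_le:
  "degree p \<le> n \<Longrightarrow> poly_apply p T v = (\<Sum>i\<le>n. coeff p i *s (((*v) T ^^ i) v))"
  unfolding poly_apply_def by (rule sum.mono_neutral_left) (auto simp: coeff_eq_0)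

lemma matrix_vector_mult_funpow_diff:
  "((*v) T ^^ i) (T *v v - \<mu> *s v) = ((*v) T ^^ Suc i) v - \<mu> *s ((*v) T ^^ i) v"
  for T :: "complex^'k^'k"
  by (induction i) (simp_all add: matrix_vector_mult_diff_distrib vector_scalar_commute)

text \<open>Moving a linear factor into the argument lowers the degree of the annihilating
  polynomial, at the price of replacing \<open>v\<close> by \<open>T v - \<mu> v\<close>; this
  drives the later induction.\<close>

lemma poly_apply_linear_factor:
  fixes T :: "complex^'k^'k"
  shows "poly_apply ([:- \<mu>, 1:] * q) T v = poly_apply q T (T *v v - \<mu> *s v)"
proof -
  let ?w = "\<lambda>i. ((*v) T ^^ i) v"
  have "degree ([:- \<mu>, 1:] * q) \<le> Suc (degree q)"
    by (rule order_trans[OF degree_mult_le]) simp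
  then have "poly_apply ([:- \<mu>, 1:] * q) T v
      = (\<Sum>i\<le>Suc (degree q). coeff ([:- \<mu>, 1:] * q) i *s ?w i)"
    by (rule poly_apply_eq_sum_le)
  also have "\<dots> = (\<Sum>i\<le>Suc (degree q). coeff (pCons 0 q) i *s ?w i)
      - \<mu> *s (\<Sum>i\<le>Suc (degree q). coeff q i *s ?w i)"
    by (simp add: vec.scale_sum_right sum_subtractf[symmetric] vec.scale_left_diff_distrib del: sum.atMost_Suc)
  also have "(\<Sum>i\<le>Suc (degree q). coeff (pCons 0 q) i *s ?w i)
      = (\<Sum>i\<le>degree q. coeff q i *s ?w (Suc i))"
    by (subst sum.atMost_Suc_shift) (simp)
  also have "(\<Sum>i\<le>Suc (degree q). coeff q i *s ?w i) = (\<Sum>i\<le>degree q. coeff q i *s ?w i)"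
    by (simp add: coeff_eq_0)
  also have "(\<Sum>i\<le>degree q. coeff q i *s ?w (Suc i)) - \<mu> *s (\<Sum>i\<le>degree q. coeff q i *s ?w i)
      = poly_apply q T (T *v v - \<mu> *s v)"
    by (simp add: poly_apply_def matrix_vector_mult_funpow_diff vec.scale_right_diff_distrib
        sum_subtractf vec.scale_sum_right mult.commute)
  finally show ?thesis .
qed

text \<open>Read together with the previous lemma: if \<open>(X - \<mu>) q\<close> annihilates
  \<open>v\<close>, then \<open>q(T) v\<close> is zero or an eigenvector for
  \<open>\<mu>\<close>.\<close>

lemma poly_apply_commute:
  fixes T :: "complex^'k^'k"
  shows "poly_apply q T (T *v v - \<mu> *s v) = T *v poly_apply q T v - \<mu> *s poly_apply q T v"
  by (simp add: poly_apply_def matrix_vector_mult_funpow_diff vec.scale_right_diff_distrib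
      sum_subtractf vec.scale_sum_right mult.commute vec.linear_sum[OF matrix_vector_mul_linear_gen]
      vector_scalar_commute)

text \<open>One more iterate of \<open>v\<close> than the dimension must be linearly dependent, and
  a dependence among iterates is a polynomial relation. Working with one vector at a time avoids the
  Jordan form and the Cayley-Hamilton theorem.\<close>

lemma exists_annihilating_poly:
  fixes T :: "complex^'k^'k"
  obtains p where "p \<noteq> 0" "poly_apply p T v = 0"
proof -
  let ?w = "\<lambda>i. ((*v) T ^^ i) v"
  \<comment> \<open>\<open>DIM\<close> is the real dimension, matching the real notion of
    dependence; the relation found below therefore has real coefficients.\<close>
  define N where "N = DIM(complex^'k)"
  show ?thesis
  proof (cases "inj_on ?w {..N}")
    case False
    then obtain i j where ij: "i \<noteq> j" "?w i = ?w j" unfolding inj_on_def by blast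
    \<comment> \<open>Coinciding iterates are treated apart, because dependence of the set of
      iterates does not see repetitions.\<close>
    let ?p = "monom 1 i - monom 1 j :: complex poly"
    have "coeff ?p i = 1" using ij(1) by simp
    then have "?p \<noteq> 0" by (metis coeff_0 zero_neq_one)
    moreover have "poly_apply ?p T v = 0"
    proof -
      have "degree ?p \<le> i + j"
        by (rule degree_diff_le) (auto intro: order_trans[OF degree_monom_le])
      then show ?thesis
        using ij(2)
        by (subst poly_apply_eq_sum_le)
          (auto simp: vec.scale_left_diff_distrib sum_subtractf if_distrib[of "\<lambda>c. c *s _"] cong: if_cong)
    qed
    ultimately show ?thesis by (rule that)
  next
    case True
    have "dependent (?w ` {..N})"
    proof (rule ccontr)
      assume "\<not> dependent (?w ` {..N})"
      then have "card (?w ` {..N}) \<le> N" unfolding N_def by (rule independent_bound[THEN conjunct2])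
      then show False using card_image[OF True] by simp
    qed
    then obtain u where u: "\<exists>x\<in>?w ` {..N}. u x \<noteq> 0" "(\<Sum>x\<in>?w ` {..N}. u x *\<^sub>R x) = 0"
      by (auto simp: dependent_finite)
    define p where "p = (\<Sum>i\<le>N. monom (complex_of_real (u (?w i))) i)"
    have coeff: "coeff p i = (if i \<le> N then complex_of_real (u (?w i)) else 0)" for i
      by (simp add: p_def coeff_sum)
    have "p \<noteq> 0"
    proof
      assume "p = 0"
      with coeff have "i \<le> N \<Longrightarrow> u (?w i) = 0" for i by (metis coeff_0 of_real_eq_0_iff)
      with u(1) show False by auto
    qed
    moreover have "poly_apply p T v = 0"
    proof -
      have "degree p \<le> N" using coeff by (intro degree_le) auto
      then have "poly_apply p T v = (\<Sum>i\<le>N. complex_of_real (u (?w i)) *s ?w i)"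
        by (subst poly_apply_eq_sum_le) (auto simp: coeff intro: sum.cong)
      also have "\<dots> = (\<Sum>i\<le>N. u (?w i) *\<^sub>R ?w i)"
        by (rule sum.cong) (auto simp: vec_eq_iff complex_eq_iff)
      also have "\<dots> = 0" using u(2) by (simp add: sum.reindex[OF True])
      finally show ?thesis .
    qed
    ultimately show ?thesis by (rule that)
  qed
qed

text \<open>A vector annihilated by \<open>p(M)\<close> is treated by splitting off one root \<open>\<mu>\<close> of \<open>p\<close>: either
  \<open>\<mu>\<close> is an eigenvalue, and a scalar differential equation with a decaying
  right-hand side results, or \<open>\<mu>\<close> can be dropped.\<close>

lemma exp_decay_mexp_apply:
  fixes M :: "real^'k^'k"
  defines "T \<equiv> map_matrix complex_of_real M"
  assumes "hurwitz M" and "p \<noteq> 0" and "poly_apply p T v = 0"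
  shows "exp_decay (\<lambda>t. \<Sum>j\<in>UNIV. complex_of_real (mexp M t $ i $ j) * v $ j)"
  using assms(3,4)
proof (induction "degree p" arbitrary: p v)
  case 0
  then obtain a where "p = [:a:]" by (metis degree_eq_zeroE)
  with 0 have "v = 0" by (auto simp: poly_apply_def)
  then show ?case by (auto simp: exp_decay_def intro!: exI[of _ 1])
next
  case (Suc n)
  have "\<not> constant (poly p)" using Suc(2) by (simp add: constant_degree)
  then obtain \<mu> where "poly p \<mu> = 0" using fundamental_theorem_of_algebra by blast
  then obtain q where p: "p = [:- \<mu>, 1:] * q" by (auto simp: poly_eq_0_iff_dvd)
  with Suc have "q \<noteq> 0" by auto
  with p Suc(2) have "degree q = n" by (simp add: degree_mult_eq del: mult_pCons_left)
  let ?v' = "T *v v - \<mu> *s v"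
  have q0: "poly_apply q T ?v' = 0" using Suc(4) by (simp only: p poly_apply_linear_factor)
  \<comment> \<open>The split is on the sign of \<open>Re \<mu>\<close>: if negative, the
    differential equation gives decay whether or not \<open>\<mu>\<close> is an eigenvalue;
    otherwise the Hurwitz property excludes it as an eigenvalue and the factor can be
    cancelled.\<close>
  show ?case
  proof (cases "Re \<mu> < 0")
    case True
    let ?f = "\<lambda>v t. \<Sum>j\<in>UNIV. complex_of_real (mexp M t $ i $ j) * v $ j"
    have "?f (T *v v) t = (\<Sum>j\<in>UNIV. complex_of_real ((mexp M t ** M) $ i $ j) * v $ j)" for t
      by (simp add: T_def matrix_vector_mult_def matrix_matrix_mult_def sum_distrib_left
          sum_distrib_right mult.assoc) (rule sum.swap)
    then have eq: "(\<Sum>j\<in>UNIV. complex_of_real ((mexp M t ** M) $ i $ j) * v $ j) = \<mu> * ?f v t + ?f ?v' t" for t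
      by (simp add: algebra_simps sum_subtractf sum_distrib_left)
    have "(?f v has_vector_derivative \<mu> * ?f v t + ?f ?v' t) (at t)" for t
      unfolding eq[symmetric]
      by (intro has_vector_derivative_sum has_vector_derivative_mult_left has_vector_derivative_of_real)
        (simp add: mexp_deriv_right has_real_derivative_iff_has_vector_derivative[symmetric])
    moreover have "exp_decay (?f ?v')"
      using Suc(1)[OF \<open>degree q = n\<close>[symmetric] \<open>q \<noteq> 0\<close> q0] .
    ultimately show ?thesis using True by (rule exp_decay_ode)
  next
    case False
    have "T *v poly_apply q T v = \<mu> *s poly_apply q T v"
      using q0 by (simp add: poly_apply_commute)
    then have "poly_apply q T v = 0"
      using \<open>hurwitz M\<close> False unfolding hurwitz_def T_def by blast
    then show ?thesis using Suc(1)[OF \<open>degree q = n\<close>[symmetric] \<open>q \<noteq> 0\<close>] by blast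
  qed
qed

lemma hurwitz_mexp_bound:
  fixes M :: "real^'k^'k"
  assumes "hurwitz M"
  obtains K \<alpha> where "\<alpha> > 0" "\<And>t i j. t \<ge> 0 \<Longrightarrow> \<bar>mexp M t $ i $ j\<bar> \<le> K * exp (- (\<alpha> * t))"
proof -
  have "\<exists>K \<alpha>. \<alpha> > 0 \<and> (\<forall>t\<ge>0. \<bar>mexp M t $ i $ j\<bar> \<le> K * exp (- (\<alpha> * t)))" for i j
  proof -
    \<comment> \<open>The basis vector \<open>axis j 1\<close> singles out column \<open>j\<close>
      of the exponential.\<close>
    obtain p where p: "p \<noteq> 0" "poly_apply p (map_matrix complex_of_real M) (axis j 1) = 0"
      by (rule exists_annihilating_poly)
    have "(\<Sum>l\<in>UNIV. complex_of_real (mexp M t $ i $ l) * axis j 1 $ l) = complex_of_real (mexp M t $ i $ j)" for t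
      by (simp add: axis_def if_distrib cong: if_cong)
    with exp_decay_mexp_apply[OF assms p, of i] show ?thesis by (simp add: exp_decay_def)
  qed
  then obtain K \<alpha> where \<alpha>: "\<And>i j. \<alpha> i j > 0"
    and K: "\<And>i j t. t \<ge> 0 \<Longrightarrow> \<bar>mexp M t $ i $ j\<bar> \<le> K i j * exp (- (\<alpha> i j * t))"
    by metis
  let ?I = "UNIV :: ('k \<times> 'k) set"
  \<comment> \<open>Finitely many entries share the slowest rate and the largest constant; absolute
    values make that constant nonnegative, so lowering the rate preserves the bound.\<close>
  define \<beta> where "\<beta> = Min ((\<lambda>(i, j). \<alpha> i j) ` ?I)"
  define L where "L = Max ((\<lambda>(i, j). \<bar>K i j\<bar>) ` ?I)"
  have "\<beta> \<in> (\<lambda>(i, j). \<alpha> i j) ` ?I" unfolding \<beta>_def by (rule Min_in) auto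
  then have "\<beta> > 0" using \<alpha> by auto
  moreover have "\<bar>mexp M t $ i $ j\<bar> \<le> L * exp (- (\<beta> * t))" if "t \<ge> 0" for t i j
  proof -
    have "\<beta> \<le> \<alpha> i j" unfolding \<beta>_def by (rule Min_le) (auto intro!: image_eqI[where x = "(i, j)"])
    moreover have "\<bar>K i j\<bar> \<le> L" unfolding L_def by (rule Max_ge) (auto intro!: image_eqI[where x = "(i, j)"])
    ultimately have "K i j * exp (- (\<alpha> i j * t)) \<le> L * exp (- (\<beta> * t))"
      using that by (intro mult_mono) (auto intro: mult_right_mono)
    with K[OF that, of i j] show ?thesis by linarith
  qed
  ultimately show ?thesis by (rule that)
qed

subsection \<open>Variation of constants\<close>

lemma integrable_pair_mult:
  fixes f :: "'a \<Rightarrow> 'c::{real_normed_field, banach, second_countable_topology}" and g :: "'b \<Rightarrow> 'c"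
  assumes "sigma_finite_measure M1" "sigma_finite_measure M2"
    and f: "integrable M1 f" and g: "integrable M2 g"
  shows "integrable (M1 \<Otimes>\<^sub>M M2) (\<lambda>(x, y). f x * g y)"
proof -
  interpret pair_sigma_finite M1 M2
    by (intro pair_sigma_finite.intro assms)
  have [measurable]: "f \<in> borel_measurable M1" "g \<in> borel_measurable M2" using f g by auto
  show ?thesis
  proof (rule Fubini_integrable)
    show "integrable M1 (\<lambda>x. \<integral>y. norm (case (x, y) of (x, y) \<Rightarrow> f x * g y) \<partial>M2)"
      using f by (simp add: norm_mult integrable_norm)
  qed (use g in auto)
qed

lemma set_integrable_continuous_mult:
  fixes f \<phi> :: "real \<Rightarrow> real"
  assumes \<phi>: "continuous_on {a..b} \<phi>" and f: "set_integrable lborel {a..b} f"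
  shows "set_integrable lborel {a..b} (\<lambda>u. \<phi> u * f u)"
proof -
  have "bounded (\<phi> ` {a..b})" by (rule compact_imp_bounded[OF compact_continuous_image[OF \<phi>]]) simp
  then obtain B where B: "\<And>u. u \<in> {a..b} \<Longrightarrow> \<bar>\<phi> u\<bar> \<le> B" unfolding bounded_iff by (metis imageI real_norm_def)
  have [measurable]: "(\<lambda>u. indicator {a..b} u * \<phi> u) \<in> borel_measurable borel"
    using borel_measurable_continuous_on_indicator[OF _ \<phi>] by simp
  have f': "integrable lborel (\<lambda>u. indicator {a..b} u * f u)"
    using f by (simp add: set_integrable_def)
  then have [measurable]: "(\<lambda>u. indicator {a..b} u * f u) \<in> borel_measurable borel" by auto
  have "integrable lborel (\<lambda>u. (indicator {a..b} u * \<phi> u) * (indicator {a..b} u * f u))"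
  proof (rule Bochner_Integration.integrable_bound)
    show "integrable lborel (\<lambda>u. B * (indicator {a..b} u * f u))" using f' by simp
    show "AE u in lborel. norm ((indicator {a..b} u * \<phi> u) * (indicator {a..b} u * f u))
        \<le> norm (B * (indicator {a..b} u * f u))"
      by (auto simp: indicator_def abs_mult intro!: AE_I2 mult_right_mono order_trans[OF B abs_ge_self])
  qed measurable
  moreover have "(indicator {a..b} u * \<phi> u) * (indicator {a..b} u * f u) = indicator {a..b} u *\<^sub>R (\<phi> u * f u)" for u
    by (simp add: indicator_def)
  ultimately show ?thesis by (simp add: set_integrable_def)
qed

text \<open>\<open>F\<close> is only an indefinite integral of an integrable function and need not
  be differentiable, so the product rule is not at hand. Fubini on the triangle
  \<open>r \<le> u\<close> takes its place. The minus sign in the hypothesis on \<open>F\<close>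
  reflects reversed time.\<close>

lemma by_parts_primitive:
  fixes \<phi> \<psi> f F :: "real \<Rightarrow> real"
  assumes "T \<ge> 0"
    and deriv: "\<And>u. (\<phi> has_real_derivative \<psi> u) (at u)" and cont: "continuous_on {0..T} \<psi>"
    and f: "set_integrable lborel {0..T} f"
    and F: "\<And>u. 0 \<le> u \<Longrightarrow> u \<le> T \<Longrightarrow> F u = F 0 - (LINT r:{0..u}|lborel. f r)"
  shows "\<phi> T * F T - \<phi> 0 * F 0
    = (LINT u:{0..T}|lborel. \<psi> u * F u) - (LINT u:{0..T}|lborel. \<phi> u * f u)"
proof -
  define \<psi>' where "\<psi>' u = indicator {0..T} u * \<psi> u" for u
  define f' where "f' u = indicator {0..T} u * f u" for u
  have \<psi>': "integrable lborel \<psi>'"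
    using borel_integrable_atLeastAtMost'[OF cont] by (simp add: \<psi>'_def[abs_def] set_integrable_def)
  have f': "integrable lborel f'"
    using f by (simp add: f'_def[abs_def] set_integrable_def)
  have [measurable]: "\<psi>' \<in> borel_measurable borel" "f' \<in> borel_measurable borel"
    using \<psi>' f' by auto
  have FTC: "(LINT u:{a..T}|lborel. \<psi> u) = \<phi> T - \<phi> a" if "0 \<le> a" "a \<le> T" for a
  proof -
    have cont_a: "continuous_on {a..T} \<psi>" using cont by (rule continuous_on_subset) (use that in auto)
    have "(\<psi> has_integral \<phi> T - \<phi> a) {a..T}"
      using that by (intro fundamental_theorem_of_calculus)
        (auto simp: has_real_derivative_iff_has_vector_derivative[symmetric] intro: DERIV_subset deriv)
    then show ?thesis
      using set_borel_integral_eq_integral(2)[OF borel_integrable_atLeastAtMost'[OF cont_a]]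
      by (simp add: integral_unique)
  qed
  \<comment> \<open>Integrating out \<open>u\<close> produces an increment of \<open>\<phi>\<close>,
    integrating out \<open>r\<close> an increment of \<open>F\<close>.\<close>
  let ?k = "\<lambda>u r. \<psi>' u * f' r * (if r \<le> u then 1 else 0)"
  have "integrable (lborel \<Otimes>\<^sub>M lborel) (\<lambda>(u, r). ?k u r)"
    by (rule Bochner_Integration.integrable_bound[OF integrable_pair_mult[OF sigma_finite_lborel sigma_finite_lborel \<psi>' f']])
      (auto simp: abs_mult)
  then have "(\<integral>r. (\<integral>u. ?k u r \<partial>lborel) \<partial>lborel) = (\<integral>u. (\<integral>r. ?k u r \<partial>lborel) \<partial>lborel)"
    by (rule lborel_pair.Fubini_integral)
  moreover have "(\<integral>u. ?k u r \<partial>lborel) = f' r * (\<phi> T - \<phi> r)" for r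
  proof (cases "0 \<le> r \<and> r \<le> T")
    case True
    then have "(\<integral>u. ?k u r \<partial>lborel) = (\<integral>u. f' r * (indicator {r..T} u *\<^sub>R \<psi> u) \<partial>lborel)"
      by (intro Bochner_Integration.integral_cong) (auto simp: \<psi>'_def indicator_def)
    also have "\<dots> = f' r * (\<phi> T - \<phi> r)"
      using FTC[of r] True by (simp add: set_lebesgue_integral_def)
    finally show ?thesis .
  qed (simp add: f'_def)
  moreover have "(\<integral>r. ?k u r \<partial>lborel) = \<psi>' u * (F 0 - F u)" for u
  proof (cases "0 \<le> u \<and> u \<le> T")
    case True
    then have "(\<integral>r. ?k u r \<partial>lborel) = (\<integral>r. \<psi>' u * (indicator {0..u} r *\<^sub>R f r) \<partial>lborel)"
      by (intro Bochner_Integration.integral_cong) (auto simp: f'_def indicator_def)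
    also have "\<dots> = \<psi>' u * (F 0 - F u)"
      using F[of u] True by (simp add: set_lebesgue_integral_def)
    finally show ?thesis .
  qed (simp add: \<psi>'_def)
  ultimately have swap: "(\<integral>r. f' r * (\<phi> T - \<phi> r) \<partial>lborel) = (\<integral>u. \<psi>' u * (F 0 - F u) \<partial>lborel)"
    by simp
  have cont_\<phi>: "continuous_on {0..T} \<phi>"
    by (rule continuous_at_imp_continuous_on) (auto intro: DERIV_isCont deriv)
  have int_\<phi>: "integrable lborel (\<lambda>u. f' u * \<phi> u)"
    using set_integrable_continuous_mult[OF cont_\<phi> f] by (simp add: set_integrable_def f'_def mult_ac)
  \<comment> \<open>\<open>F\<close> inherits continuity from its integral representation. This
    makes \<open>\<psi>' u * F u\<close> integrable, so that the integral over \<open>u\<close> may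
    be split.\<close>
  have "f integrable_on {0..T}" by (rule set_borel_integral_eq_integral[OF f])
  then have "continuous_on {0..T} (\<lambda>u. F 0 - integral {0..u} f)"
    by (intro continuous_intros indefinite_integral_continuous_1)
  moreover have "F 0 - integral {0..u} f = F u" if "u \<in> {0..T}" for u
  proof -
    have "set_integrable lborel {0..u} f" using f by (rule set_integrable_subset) (use that in auto)
    with F[of u] that show ?thesis by (simp add: set_borel_integral_eq_integral(2))
  qed
  ultimately have cont_F: "continuous_on {0..T} F"
    by (rule continuous_on_eq)
  have int_F: "integrable lborel (\<lambda>u. \<psi>' u * F u)"
    using borel_integrable_atLeastAtMost'[OF continuous_on_mult[OF cont cont_F]]
    by (simp add: set_integrable_def \<psi>'_def mult_ac)
  have "(\<integral>r. f' r * (\<phi> T - \<phi> r) \<partial>lborel) = (F 0 - F T) * \<phi> T - (LINT u:{0..T}|lborel. \<phi> u * f u)"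
  proof -
    have "(\<integral>r. f' r * (\<phi> T - \<phi> r) \<partial>lborel) = (\<integral>r. f' r \<partial>lborel) * \<phi> T - (\<integral>r. f' r * \<phi> r \<partial>lborel)"
      using f' int_\<phi> by (simp add: right_diff_distrib)
    moreover have "(\<integral>r. f' r \<partial>lborel) = F 0 - F T"
      using F[of T] \<open>T \<ge> 0\<close> by (simp add: f'_def[abs_def] set_lebesgue_integral_def)
    moreover have "(\<integral>r. f' r * \<phi> r \<partial>lborel) = (LINT u:{0..T}|lborel. \<phi> u * f u)"
      by (simp add: set_lebesgue_integral_def f'_def mult_ac)
    ultimately show ?thesis by simp
  qed
  moreover have "(\<integral>u. \<psi>' u * (F 0 - F u) \<partial>lborel) = F 0 * (\<phi> T - \<phi> 0) - (LINT u:{0..T}|lborel. \<psi> u * F u)"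
  proof -
    have "(\<integral>u. \<psi>' u * (F 0 - F u) \<partial>lborel) = (\<integral>u. \<psi>' u \<partial>lborel) * F 0 - (\<integral>u. \<psi>' u * F u \<partial>lborel)"
      using \<psi>' int_F by (simp add: right_diff_distrib)
    moreover have "(\<integral>u. \<psi>' u \<partial>lborel) = \<phi> T - \<phi> 0"
      using FTC[of 0] \<open>T \<ge> 0\<close> by (simp add: \<psi>'_def[abs_def] set_lebesgue_integral_def)
    moreover have "(\<integral>u. \<psi>' u * F u \<partial>lborel) = (LINT u:{0..T}|lborel. \<psi> u * F u)"
      by (simp add: set_lebesgue_integral_def \<psi>'_def mult_ac)
    ultimately show ?thesis by simp
  qed
  ultimately show ?thesis using swap by (simp add: algebra_simps)
qed

lemma has_integral_reflect_at:
  fixes f :: "real \<Rightarrow> 'b::real_normed_vector"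
  assumes "(f has_integral I) {t - u..t}"
  shows "((\<lambda>r. f (t - r)) has_integral I) {0..u}"
proof -
  have "((\<lambda>r. f (- r)) has_integral I) {- t..- (t - u)}"
    using assms by (simp only: has_integral_reflect_real)
  from has_integral_shift_real_ivl[OF this, of "- t"] show ?thesis by simp
qed

text \<open>The row \<open>r exp(M u)\<close> is paired with the time-reversed state.
  Differentiating the row gives \<open>r exp(M u) M\<close>, which cancels the term
  \<open>M \<xi>\<close> of the equation and leaves the forcing alone. A single functional
  \<open>r\<close> is tracked because moments are later known only for some functionals.\<close>

lemma linear_ode_variation_of_constants:
  fixes M :: "real^'k^'k" and r :: "real^'k" and \<xi> g :: "real \<Rightarrow> real^'k"
  assumes "T \<ge> 0"
    and ode: "\<And>s t. s \<le> t \<Longrightarrow> ((\<lambda>u. M *v \<xi> u + g u) has_integral (\<xi> t - \<xi> s)) {s..t}"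
    and g: "\<And>l. set_integrable lborel {0..T} (\<lambda>u. g (t - u) $ l)"
  shows "r \<bullet> \<xi> t = (r v* mexp M T) \<bullet> \<xi> (t - T)
    + (LINT u:{0..T}|lborel. (r v* mexp M u) \<bullet> g (t - u))"
proof -
  define \<phi> where "\<phi> l u = (r v* mexp M u) $ l" for l u
  define \<psi> where "\<psi> l u = ((r v* mexp M u) v* M) $ l" for l u
  define F where "F l u = \<xi> (t - u) $ l" for l u
  define h where "h l u = (M *v \<xi> (t - u)) $ l" for l u
  define f where "f l u = h l u + g (t - u) $ l" for l u
  have f_has: "(f l has_integral F l 0 - F l u) {0..u}" if "0 \<le> u" for l u
  proof -
    have "((\<lambda>r. M *v \<xi> (t - r) + g (t - r)) has_integral (\<xi> t - \<xi> (t - u))) {0..u}"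
      using that by (intro has_integral_reflect_at ode) auto
    from has_integral_linear[OF this bounded_linear_vec_nth[of l]] show ?thesis
      by (simp add: o_def f_def[abs_def] F_def h_def)
  qed
  \<comment> \<open>Continuity of the path comes from the equation, as continuity of an indefinite
    gauge integral. It makes the drift Lebesgue integrable on the window.\<close>
  have cont_F: "continuous_on {0..T} (F l)" for l
  proof -
    have "continuous_on {0..T} (\<lambda>u. F l 0 - integral {0..u} (f l))"
      using f_has[OF \<open>T \<ge> 0\<close>] by (intro continuous_intros indefinite_integral_continuous_1) auto
    moreover have "F l 0 - integral {0..u} (f l) = F l u" if "u \<in> {0..T}" for u
      using f_has[of u l] that by (simp add: integral_unique)
    ultimately show ?thesis by (rule continuous_on_eq)
  qed
  have h_eq: "h l u = (\<Sum>k\<in>UNIV. M $ l $ k * F k u)" for l u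
    by (simp add: h_def F_def matrix_vector_mult_def)
  have cont_h: "continuous_on {0..T} (h l)" for l
    unfolding h_eq[abs_def] by (intro continuous_intros cont_F)
  have f: "set_integrable lborel {0..T} (f l)" for l
    unfolding f_def[abs_def] by (intro set_integral_add borel_integrable_atLeastAtMost' cont_h g)
  have \<phi>_eq: "\<phi> l u = (\<Sum>i\<in>UNIV. r $ i * mexp M u $ i $ l)" for l u
    by (simp add: \<phi>_def vector_matrix_mult_def mult.commute)
  have \<psi>_eq: "\<psi> l u = (\<Sum>i\<in>UNIV. r $ i * (mexp M u ** M) $ i $ l)" for l u
    unfolding \<psi>_def vector_matrix_mul_assoc
    by (simp add: vector_matrix_mult_def)
  have \<psi>_eq': "\<psi> l u = (\<Sum>k\<in>UNIV. \<phi> k u * M $ k $ l)" for l u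
    by (simp add: \<psi>_def \<phi>_def vector_matrix_mult_def mult.commute)
  have deriv: "(\<phi> l has_real_derivative \<psi> l u) (at u)" for l u
    unfolding \<phi>_eq[abs_def] \<psi>_eq by (auto intro!: derivative_eq_intros mexp_deriv_right simp: mult.commute)
  have cont_\<phi>: "continuous_on {0..T} (\<phi> l)" for l
    unfolding \<phi>_eq[abs_def] by (intro continuous_intros)
  have cont_\<psi>: "continuous_on {0..T} (\<psi> l)" for l
    unfolding \<psi>_eq'[abs_def] by (intro continuous_intros cont_\<phi>)
  have parts: "\<phi> l T * F l T - \<phi> l 0 * F l 0
    = (LINT u:{0..T}|lborel. \<psi> l u * F l u) - (LINT u:{0..T}|lborel. \<phi> l u * f l u)" for l
  proof (rule by_parts_primitive[OF \<open>T \<ge> 0\<close> deriv cont_\<psi> f])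
    fix u assume "0 \<le> u" "u \<le> T"
    then have "set_integrable lborel {0..u} (f l)" by (intro set_integrable_subset[OF f]) auto
    with f_has[OF \<open>0 \<le> u\<close>, of l] show "F l u = F l 0 - (LINT r:{0..u}|lborel. f l r)"
      by (simp add: set_borel_integral_eq_integral(2) integral_unique)
  qed
  have int1: "set_integrable lborel {0..T} (\<lambda>u. \<psi> l u * F l u)" for l
    by (intro borel_integrable_atLeastAtMost' continuous_on_mult cont_\<psi> cont_F)
  have int2: "set_integrable lborel {0..T} (\<lambda>u. \<phi> l u * f l u)" for l
    by (intro set_integrable_continuous_mult cont_\<phi> f)
  have "(\<Sum>l\<in>UNIV. \<phi> l T * F l T) - (\<Sum>l\<in>UNIV. \<phi> l 0 * F l 0)
      = (\<Sum>l\<in>UNIV. LINT u:{0..T}|lborel. (\<psi> l u * F l u - \<phi> l u * f l u))"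
    by (simp add: sum_subtractf[symmetric] parts int1 int2)
  also have "\<dots> = (LINT u:{0..T}|lborel. (\<Sum>l\<in>UNIV. \<psi> l u * F l u - \<phi> l u * f l u))"
    unfolding set_lebesgue_integral_def scaleR_sum_right
    by (rule Bochner_Integration.integral_sum[symmetric])
      (use set_integral_diff(1)[OF int1 int2] in \<open>simp add: set_integrable_def\<close>)
  also have "(\<lambda>u. \<Sum>l\<in>UNIV. \<psi> l u * F l u - \<phi> l u * f l u) = (\<lambda>u. - ((r v* mexp M u) \<bullet> g (t - u)))"
  proof
    fix u
    \<comment> \<open>The cancellation: \<open>M\<close> passes from the row to the state under the
      inner product.\<close>
    have "(\<Sum>l\<in>UNIV. \<psi> l u * F l u) = (\<Sum>l\<in>UNIV. \<phi> l u * h l u)"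
      by (simp add: \<psi>_eq' h_eq sum_distrib_left sum_distrib_right mult.assoc) (rule sum.swap)
    then show "(\<Sum>l\<in>UNIV. \<psi> l u * F l u - \<phi> l u * f l u) = - ((r v* mexp M u) \<bullet> g (t - u))"
      by (simp add: sum_subtractf f_def distrib_left sum.distrib inner_vec_def \<phi>_def)
  qed
  also have "(LINT u:{0..T}|lborel. - ((r v* mexp M u) \<bullet> g (t - u)))
      = - (LINT u:{0..T}|lborel. (r v* mexp M u) \<bullet> g (t - u))"
    by (simp add: set_lebesgue_integral_def)
  finally show ?thesis
    by (simp add: \<phi>_def F_def inner_vec_def)
qed

subsection \<open>Filtered second-order processes\<close>

text \<open>A uniform first-moment bound lets \<open>C * H\<close> dominate the iterated integral of
  norms. The index \<open>z\<close> is a single time for one filter and a pair of times for a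
  product of two.\<close>

lemma integrable_weighted_process:
  fixes H :: "'z \<Rightarrow> real" and V :: "'z \<Rightarrow> 'a \<Rightarrow> real"
  assumes "sigma_finite_measure N" "sigma_finite_measure P"
    and H: "integrable N H"
    and V [measurable]: "(\<lambda>(z, p). V z p) \<in> borel_measurable (N \<Otimes>\<^sub>M P)"
    and int: "\<And>z. integrable P (V z)" and bound: "\<And>z. (\<integral>p. \<bar>V z p\<bar> \<partial>P) \<le> C"
  shows "integrable (N \<Otimes>\<^sub>M P) (\<lambda>(z, p). H z * V z p)"
proof -
  interpret pair_sigma_finite N P by (intro pair_sigma_finite.intro assms)
  have [measurable]: "H \<in> borel_measurable N" using H by auto
  show ?thesis
  proof (rule Fubini_integrable)
    show "integrable N (\<lambda>z. \<integral>p. norm (case (z, p) of (z, p) \<Rightarrow> H z * V z p) \<partial>P)"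
    proof (rule Bochner_Integration.integrable_bound)
      show "integrable N (\<lambda>z. C * H z)" using H by simp
      show "AE z in N. norm (\<integral>p. norm (case (z, p) of (z, p) \<Rightarrow> H z * V z p) \<partial>P) \<le> norm (C * H z)"
      proof (rule AE_I2)
        fix z
        have "(\<integral>p. \<bar>V z p\<bar> \<partial>P) \<ge> 0" by simp
        then show "norm (\<integral>p. norm (case (z, p) of (z, p) \<Rightarrow> H z * V z p) \<partial>P) \<le> norm (C * H z)"
          using mult_left_mono[OF order_trans[OF bound[of z] abs_ge_self], of "\<bar>H z\<bar>"]
          by (simp add: abs_mult mult.commute)
      qed
    qed measurable
  qed (use int in auto)
qed

text \<open>The pathwise convolution of \<open>g\<close> with a path of \<open>X\<close>. Where the
  integrand is not integrable it takes the default value \<open>0\<close>; for integrable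
  \<open>g\<close> and a bounded process this concerns only a null set of paths at each
  time.\<close>

definition filtered :: "(real \<Rightarrow> real) \<Rightarrow> (real \<Rightarrow> 'a \<Rightarrow> real) \<Rightarrow> real \<Rightarrow> 'a \<Rightarrow> real" where
  "filtered g X t p = (\<integral>u. g u * X (t - u) p \<partial>lborel)"

text \<open>Joint measurability is what Fubini requires; the time-uniform second moment is the part
  of stationarity used to estimate filters.\<close>

definition bounded_process :: "'a measure \<Rightarrow> real \<Rightarrow> (real \<Rightarrow> 'a \<Rightarrow> real) \<Rightarrow> bool" where
  "bounded_process P \<rho> X \<longleftrightarrow> (\<lambda>(t, p). X t p) \<in> borel_measurable (borel \<Otimes>\<^sub>M P) \<and>
     (\<forall>t. integrable P (\<lambda>p. (X t p)\<^sup>2) \<and> (\<integral>p. (X t p)\<^sup>2 \<partial>P) \<le> \<rho>)"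

lemma bounded_process_measurable:
  assumes "bounded_process P \<rho> X" and [measurable]: "f \<in> N \<rightarrow>\<^sub>M borel" "h \<in> N \<rightarrow>\<^sub>M P"
  shows "(\<lambda>z. X (f z) (h z)) \<in> borel_measurable N"
proof -
  have X: "(\<lambda>(t, p). X t p) \<in> borel_measurable (borel \<Otimes>\<^sub>M P)" using assms(1) by (simp add: bounded_process_def)
  have "(\<lambda>z. (f z, h z)) \<in> N \<rightarrow>\<^sub>M borel \<Otimes>\<^sub>M P" by measurable
  from measurable_compose[OF this X] show ?thesis by simp
qed

lemma abs_mult_le_squares: "\<bar>a * b\<bar> \<le> (a\<^sup>2 + b\<^sup>2) / 2" for a b :: real
proof -
  have "0 \<le> (\<bar>a\<bar> - \<bar>b\<bar>)\<^sup>2" by simp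
  then show ?thesis by (simp add: power2_diff abs_mult)
qed

lemma bounded_process_mult:
  assumes "bounded_process P \<rho> X" "bounded_process P \<rho> Y"
  shows "integrable P (\<lambda>p. X s p * Y t p)" and "(\<integral>p. \<bar>X s p * Y t p\<bar> \<partial>P) \<le> \<rho>"
proof -
  have X: "integrable P (\<lambda>p. (X s p)\<^sup>2)" "(\<integral>p. (X s p)\<^sup>2 \<partial>P) \<le> \<rho>"
    and Y: "integrable P (\<lambda>p. (Y t p)\<^sup>2)" "(\<integral>p. (Y t p)\<^sup>2 \<partial>P) \<le> \<rho>"
    using assms by (auto simp: bounded_process_def)
  have [measurable]: "X s \<in> borel_measurable P" "Y t \<in> borel_measurable P"
    using bounded_process_measurable[OF assms(1), of "\<lambda>_. s" P "\<lambda>p. p"]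
      bounded_process_measurable[OF assms(2), of "\<lambda>_. t" P "\<lambda>p. p"] by simp_all
  have dom: "integrable P (\<lambda>p. ((X s p)\<^sup>2 + (Y t p)\<^sup>2) / 2)" using X Y by simp
  show int: "integrable P (\<lambda>p. X s p * Y t p)"
    by (rule Bochner_Integration.integrable_bound[OF dom])
      (use abs_mult_le_squares in auto)
  have "(\<integral>p. \<bar>X s p * Y t p\<bar> \<partial>P) \<le> (\<integral>p. ((X s p)\<^sup>2 + (Y t p)\<^sup>2) / 2 \<partial>P)"
    by (intro integral_mono integrable_abs int dom abs_mult_le_squares)
  also have "\<dots> \<le> \<rho>" using X Y by simp
  finally show "(\<integral>p. \<bar>X s p * Y t p\<bar> \<partial>P) \<le> \<rho>" .
qed

lemma filtered_measurable:
  assumes X: "bounded_process P \<rho> X" and g: "integrable lborel g"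
  shows "filtered g X t \<in> borel_measurable P"
proof -
  have [measurable]: "g \<in> borel_measurable borel" using g by auto
  have [measurable]: "(\<lambda>z. X (t - snd z) (fst z)) \<in> borel_measurable (P \<Otimes>\<^sub>M lborel)"
    by (rule bounded_process_measurable[OF X]) measurable
  have "(\<lambda>(p, u). g u * X (t - u) p) \<in> borel_measurable (P \<Otimes>\<^sub>M lborel)"
    by (simp add: split_beta')
  then show ?thesis
    unfolding filtered_def[abs_def] by (rule lborel.borel_measurable_lebesgue_integral)
qed

lemma filtered_AE_integrable:
  assumes "prob_space P" and X: "bounded_process P \<rho> X" and g: "integrable lborel g"
  shows "AE p in P. integrable lborel (\<lambda>u. g u * X (t - u) p)"
proof -
  interpret prob_space P by fact
  have P: "sigma_finite_measure P" by (rule sigma_finite_measure_axioms)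
  interpret pair_sigma_finite lborel P by (intro pair_sigma_finite.intro sigma_finite_lborel P)
  \<comment> \<open>Pairing \<open>X\<close> with the constant process \<open>1\<close> turns the
    bound on products into a first-moment bound; \<open>max \<rho> 1\<close> dominates both second
    moments.\<close>
  have one: "bounded_process P (max \<rho> 1) (\<lambda>t p. 1)" "bounded_process P (max \<rho> 1) X"
    using X by (auto simp: bounded_process_def prob_space max_def intro: order_trans)
  have "integrable (lborel \<Otimes>\<^sub>M P) (\<lambda>(u, p). g u * X (t - u) p)"
    using bounded_process_mult[OF one(2,1)] g
    by (intro integrable_weighted_process[where C = "max \<rho> 1"])
      (auto simp: split_beta' sigma_finite_lborel P
        intro!: bounded_process_measurable[OF X])
  from AE_integrable_snd[OF this] show ?thesis .
qed

text \<open>For almost every path the product of two filters is one integral over pairs of delays,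
  with which the expectation can be interchanged.\<close>

lemma filtered_covariance:
  assumes "prob_space P" and X: "bounded_process P \<rho> X" and Y: "bounded_process P \<rho> Y"
    and g: "integrable lborel g" and h: "integrable lborel h"
  shows "integrable P (\<lambda>p. filtered g X s p * filtered h Y t p)"
    and "(\<integral>p. filtered g X s p * filtered h Y t p \<partial>P)
      = (\<integral>(u, v). g u * h v * (\<integral>p. X (s - u) p * Y (t - v) p \<partial>P) \<partial>(lborel \<Otimes>\<^sub>M lborel))"
proof -
  interpret prob_space P by fact
  let ?N = "lborel \<Otimes>\<^sub>M lborel :: (real \<times> real) measure"
  have sigma: "sigma_finite_measure ?N" by (rule lborel_pair.sigma_finite_measure_axioms)
  interpret N: pair_sigma_finite ?N P by (intro pair_sigma_finite.intro sigma sigma_finite_measure_axioms)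
  let ?H = "\<lambda>z. g (fst z) * h (snd z)"
  let ?V = "\<lambda>z p. X (s - fst z) p * Y (t - snd z) p"
  have H: "integrable ?N ?H"
    using integrable_pair_mult[OF sigma_finite_lborel sigma_finite_lborel g h] by (simp add: split_beta')
  have int: "integrable (?N \<Otimes>\<^sub>M P) (\<lambda>(z, p). ?H z * ?V z p)"
  proof (rule integrable_weighted_process[OF sigma sigma_finite_measure_axioms H])
    have [measurable]: "(\<lambda>z. X (s - fst (fst z)) (snd z)) \<in> borel_measurable (?N \<Otimes>\<^sub>M P)"
      "(\<lambda>z. Y (t - snd (fst z)) (snd z)) \<in> borel_measurable (?N \<Otimes>\<^sub>M P)"
      by (rule bounded_process_measurable[OF X] bounded_process_measurable[OF Y]; measurable)+
    show "(\<lambda>(z, p). ?V z p) \<in> borel_measurable (?N \<Otimes>\<^sub>M P)"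
      by (simp add: split_beta')
  qed (rule bounded_process_mult[OF X Y])+
  have AE: "AE p in P. (\<integral>z. ?H z * ?V z p \<partial>?N) = filtered g X s p * filtered h Y t p"
    using filtered_AE_integrable[OF \<open>prob_space P\<close> X g, of s]
      filtered_AE_integrable[OF \<open>prob_space P\<close> Y h, of t]
  proof eventually_elim
    case (elim p)
    have "(\<integral>z. ?H z * ?V z p \<partial>?N) = (\<integral>(u, v). (g u * X (s - u) p) * (h v * Y (t - v) p) \<partial>?N)"
      by (simp add: split_beta' mult_ac)
    also have "\<dots> = (\<integral>u. \<integral>v. (g u * X (s - u) p) * (h v * Y (t - v) p) \<partial>lborel \<partial>lborel)"
      by (rule lborel_pair.integral_fst[symmetric])
        (rule integrable_pair_mult[OF sigma_finite_lborel sigma_finite_lborel elim])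
    also have "\<dots> = filtered g X s p * filtered h Y t p"
      by (simp add: filtered_def)
    finally show ?case .
  qed
  have [measurable]: "filtered g X s \<in> borel_measurable P" "filtered h Y t \<in> borel_measurable P"
    by (rule filtered_measurable[OF X g] filtered_measurable[OF Y h])+
  have meas: "(\<lambda>p. \<integral>z. ?H z * ?V z p \<partial>?N) \<in> borel_measurable P"
    using N.integrable_snd[OF int] by auto
  show "integrable P (\<lambda>p. filtered g X s p * filtered h Y t p)"
    using N.integrable_snd[OF int] by (subst integrable_cong_AE[OF _ _ AE, symmetric]) (use meas in auto)
  have "(\<integral>p. filtered g X s p * filtered h Y t p \<partial>P) = (\<integral>p. \<integral>z. ?H z * ?V z p \<partial>?N \<partial>P)"
    by (rule integral_cong_AE[symmetric, OF _ _ AE]) (use meas in auto)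
  also have "\<dots> = (\<integral>z. \<integral>p. ?H z * ?V z p \<partial>P \<partial>?N)"
    by (rule N.Fubini_integral[OF int])
  finally show "(\<integral>p. filtered g X s p * filtered h Y t p \<partial>P)
      = (\<integral>(u, v). g u * h v * (\<integral>p. X (s - u) p * Y (t - v) p \<partial>P) \<partial>?N)"
    by (simp add: split_beta')
qed

text \<open>A Young-type estimate: the covariance kernel is at most \<open>\<rho>\<close> in
  absolute value, so the L1 norm of \<open>g\<close> controls the filter in mean square. This is why
  an L1-small tail of an impulse response is harmless.\<close>

lemma filtered_second_moment_le:
  assumes "prob_space P" and X: "bounded_process P \<rho> X" and g: "integrable lborel g"
  shows "integrable P (\<lambda>p. (filtered g X t p)\<^sup>2)"
    and "(\<integral>p. (filtered g X t p)\<^sup>2 \<partial>P) \<le> \<rho> * (\<integral>u. \<bar>g u\<bar> \<partial>lborel)\<^sup>2"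
proof -
  note cov = filtered_covariance[OF \<open>prob_space P\<close> X X g g, of t t]
  show "integrable P (\<lambda>p. (filtered g X t p)\<^sup>2)" using cov(1) by (simp add: power2_eq_square)
  let ?N = "lborel \<Otimes>\<^sub>M lborel :: (real \<times> real) measure"
  have abs_g: "integrable lborel (\<lambda>u. \<bar>g u\<bar>)" using g by (rule integrable_abs)
  have prod: "integrable ?N (\<lambda>(u, v). \<bar>g u\<bar> * \<bar>g v\<bar>)"
    by (rule integrable_pair_mult[OF sigma_finite_lborel sigma_finite_lborel abs_g abs_g])
  have "(\<integral>p. (filtered g X t p)\<^sup>2 \<partial>P)
      = (\<integral>(u, v). g u * g v * (\<integral>p. X (t - u) p * X (t - v) p \<partial>P) \<partial>?N)"
    using cov(2) by (simp add: power2_eq_square)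
  also have "\<dots> \<le> (\<integral>(u, v). (\<bar>g u\<bar> * \<bar>g v\<bar>) * \<rho> \<partial>?N)"
  proof (rule integral_mono')
    show "integrable ?N (\<lambda>(u, v). (\<bar>g u\<bar> * \<bar>g v\<bar>) * \<rho>)"
      using integrable_mult_left[OF prod, of \<rho>] by (simp add: split_beta')
    fix z :: "real \<times> real"
    obtain u v where z: "z = (u, v)" by force
    have "\<bar>\<integral>p. X (t - u) p * X (t - v) p \<partial>P\<bar> \<le> \<rho>"
      using integral_abs_bound bounded_process_mult(2)[OF X X] by (rule order_trans)
    from mult_left_mono[OF this, of "\<bar>g u\<bar> * \<bar>g v\<bar>"]
    show "(case z of (u, v) \<Rightarrow> g u * g v * (\<integral>p. X (t - u) p * X (t - v) p \<partial>P))
        \<le> (case z of (u, v) \<Rightarrow> (\<bar>g u\<bar> * \<bar>g v\<bar>) * \<rho>)"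
      unfolding z by (simp add: abs_mult[symmetric])
    show "0 \<le> (case z of (u, v) \<Rightarrow> (\<bar>g u\<bar> * \<bar>g v\<bar>) * \<rho>)"
      using \<open>\<bar>_\<bar> \<le> \<rho>\<close> unfolding z by (auto intro!: mult_nonneg_nonneg)
  qed
  also have "\<dots> = (\<integral>(u, v). \<bar>g u\<bar> * \<bar>g v\<bar> \<partial>?N) * \<rho>"
    by (simp add: split_beta')
  also have "(\<integral>(u, v). \<bar>g u\<bar> * \<bar>g v\<bar> \<partial>?N) = (\<integral>u. \<bar>g u\<bar> \<partial>lborel)\<^sup>2"
    by (subst lborel_pair.integral_fst[OF prod, symmetric]) (simp add: power2_eq_square)
  finally show "(\<integral>p. (filtered g X t p)\<^sup>2 \<partial>P) \<le> \<rho> * (\<integral>u. \<bar>g u\<bar> \<partial>lborel)\<^sup>2"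
    by (simp add: mult.commute)
qed

text \<open>Unobservable components of the state may fail to be square integrable, hence the subspace \<open>V\<close>;
  it contains the rows of \<open>C exp(M T)\<close> for \<open>T \<ge> 0\<close>.\<close>

lemma bounded_functionals_uniform:
  fixes x :: "real \<Rightarrow> 'a \<Rightarrow> real^'k"
  assumes meas: "\<And>t. x t \<in> borel_measurable P"
  defines "V \<equiv> {v. \<exists>K. \<forall>s. integrable P (\<lambda>p. (v \<bullet> x s p)\<^sup>2) \<and> (\<integral>p. (v \<bullet> x s p)\<^sup>2 \<partial>P) \<le> K}"
  obtains K where "\<And>v s. v \<in> V \<Longrightarrow> integrable P (\<lambda>p. (v \<bullet> x s p)\<^sup>2)"
    "\<And>v s. v \<in> V \<Longrightarrow> (\<integral>p. (v \<bullet> x s p)\<^sup>2 \<partial>P) \<le> K * (norm v)\<^sup>2"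
proof -
  note [measurable] = meas
  have "subspace V"
  proof (rule subspaceI)
    show "0 \<in> V" by (auto simp: V_def intro: exI[of _ 0])
  next
    fix a b assume "a \<in> V" "b \<in> V"
    then obtain K L where K: "\<And>s. integrable P (\<lambda>p. (a \<bullet> x s p)\<^sup>2)" "\<And>s. (\<integral>p. (a \<bullet> x s p)\<^sup>2 \<partial>P) \<le> K"
      and L: "\<And>s. integrable P (\<lambda>p. (b \<bullet> x s p)\<^sup>2)" "\<And>s. (\<integral>p. (b \<bullet> x s p)\<^sup>2 \<partial>P) \<le> L"
      unfolding V_def by blast
    have le: "((a + b) \<bullet> x s p)\<^sup>2 \<le> 2 * (a \<bullet> x s p)\<^sup>2 + 2 * (b \<bullet> x s p)\<^sup>2" for s p
      using zero_le_power2[of "a \<bullet> x s p - b \<bullet> x s p"]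
      by (simp add: inner_add_left power2_sum power2_diff)
    have dom: "integrable P (\<lambda>p. 2 * (a \<bullet> x s p)\<^sup>2 + 2 * (b \<bullet> x s p)\<^sup>2)" for s using K L by simp
    have int: "integrable P (\<lambda>p. ((a + b) \<bullet> x s p)\<^sup>2)" for s
      by (rule Bochner_Integration.integrable_bound[OF dom[of s]]) (use le[of s] in auto)
    have "(\<integral>p. ((a + b) \<bullet> x s p)\<^sup>2 \<partial>P) \<le> 2 * K + 2 * L" for s
    proof -
      have "(\<integral>p. ((a + b) \<bullet> x s p)\<^sup>2 \<partial>P) \<le> (\<integral>p. 2 * (a \<bullet> x s p)\<^sup>2 + 2 * (b \<bullet> x s p)\<^sup>2 \<partial>P)"
        by (rule integral_mono[OF int dom le])
      also have "\<dots> \<le> 2 * K + 2 * L" using K L by (simp add: add_mono)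
      finally show ?thesis .
    qed
    with int show "a + b \<in> V" unfolding V_def by blast
  next
    fix c and a :: "real^'k" assume "a \<in> V"
    then obtain K where K: "\<And>s. integrable P (\<lambda>p. (a \<bullet> x s p)\<^sup>2)" "\<And>s. (\<integral>p. (a \<bullet> x s p)\<^sup>2 \<partial>P) \<le> K"
      unfolding V_def by blast
    have "integrable P (\<lambda>p. ((c *\<^sub>R a) \<bullet> x s p)\<^sup>2) \<and> (\<integral>p. ((c *\<^sub>R a) \<bullet> x s p)\<^sup>2 \<partial>P) \<le> c\<^sup>2 * K" for s
      using K[of s] by (auto simp: power_mult_distrib intro: mult_left_mono)
    then show "c *\<^sub>R a \<in> V" unfolding V_def by blast
  qed
  \<comment> \<open>Each vector of \<open>V\<close> has its own constant. A finite orthonormal basis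
    turns these into one quadratic bound, by expanding \<open>v\<close> and applying
    Cauchy-Schwarz.\<close>
  then obtain E where E: "E \<subseteq> V" "pairwise orthogonal E" "\<And>e. e \<in> E \<Longrightarrow> norm e = 1"
    "independent E" "span E = V"
    by (rule orthonormal_basis_subspace) blast
  have "finite E" using E(4) by (rule independent_imp_finite)
  from E(1) have "\<forall>e\<in>E. \<exists>K. \<forall>s. integrable P (\<lambda>p. (e \<bullet> x s p)\<^sup>2) \<and> (\<integral>p. (e \<bullet> x s p)\<^sup>2 \<partial>P) \<le> K"
    unfolding V_def by blast
  then obtain K where K: "\<And>e s. e \<in> E \<Longrightarrow> integrable P (\<lambda>p. (e \<bullet> x s p)\<^sup>2)"
    "\<And>e s. e \<in> E \<Longrightarrow> (\<integral>p. (e \<bullet> x s p)\<^sup>2 \<partial>P) \<le> K e"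
    by metis
  have le: "(v \<bullet> x s p)\<^sup>2 \<le> (card E * (norm v)\<^sup>2) * (\<Sum>e\<in>E. (e \<bullet> x s p)\<^sup>2)" if "v \<in> V" for v s p
  proof -
    have "v = (\<Sum>e\<in>E. (v \<bullet> e) *\<^sub>R e)"
      using orthonormal_basis_expand[OF E(2) E(3), of v] that \<open>finite E\<close> E(5) by simp
    then have "v \<bullet> x s p = (\<Sum>e\<in>E. (v \<bullet> e) * (e \<bullet> x s p))"
      by (metis (mono_tags, lifting) inner_scaleR_left inner_sum_left sum.cong)
    then have "(v \<bullet> x s p)\<^sup>2 \<le> (\<Sum>e\<in>E. (v \<bullet> e)\<^sup>2) * (\<Sum>e\<in>E. (e \<bullet> x s p)\<^sup>2)"
      by (simp add: Cauchy_Schwarz_ineq_sum)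
    also have "\<dots> \<le> (card E * (norm v)\<^sup>2) * (\<Sum>e\<in>E. (e \<bullet> x s p)\<^sup>2)"
    proof (intro mult_right_mono sum_bounded_above sum_nonneg zero_le_power2)
      fix e assume "e \<in> E"
      with E(3) Cauchy_Schwarz_ineq2[of v e] show "(v \<bullet> e)\<^sup>2 \<le> (norm v)\<^sup>2"
        by (simp add: abs_le_square_iff[symmetric])
    qed
    finally show ?thesis .
  qed
  have dom: "integrable P (\<lambda>p. (card E * (norm v)\<^sup>2) * (\<Sum>e\<in>E. (e \<bullet> x s p)\<^sup>2))" for v s
    using K(1) by auto
  show ?thesis
  proof (rule that)
    fix v s assume v: "v \<in> V"
    show int: "integrable P (\<lambda>p. (v \<bullet> x s p)\<^sup>2)"
      by (rule Bochner_Integration.integrable_bound[OF dom[of v s]])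
        (auto intro!: AE_I2 order_trans[OF le[OF v] abs_ge_self])
    have "(\<integral>p. (v \<bullet> x s p)\<^sup>2 \<partial>P) \<le> (\<integral>p. (card E * (norm v)\<^sup>2) * (\<Sum>e\<in>E. (e \<bullet> x s p)\<^sup>2) \<partial>P)"
      by (rule integral_mono[OF int dom le[OF v]])
    also have "\<dots> = (card E * (norm v)\<^sup>2) * (\<Sum>e\<in>E. \<integral>p. (e \<bullet> x s p)\<^sup>2 \<partial>P)"
      using K(1) by simp
    also have "\<dots> \<le> (card E * (norm v)\<^sup>2) * (\<Sum>e\<in>E. K e)"
      using K(2) by (intro mult_left_mono sum_mono) auto
    finally show "(\<integral>p. (v \<bullet> x s p)\<^sup>2 \<partial>P) \<le> (card E * (\<Sum>e\<in>E. K e)) * (norm v)\<^sup>2"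
      by (simp add: mult_ac)
  qed
qed

subsection \<open>The stationary output\<close>

text \<open>The indicator makes the response causal, so that \<open>filtered\<close> may integrate
  over the whole line.\<close>

definition impulse :: "real^'k^'k \<Rightarrow> real^'m^'k \<Rightarrow> real^'k^'o \<Rightarrow> 'o \<Rightarrow> 'm \<Rightarrow> real \<Rightarrow> real" where
  "impulse M B C i j u = indicator {0..} u * (C ** mexp M u ** B) $ i $ j"

lemma integrable_mexp:
  fixes M :: "real^'k^'k"
  assumes "hurwitz M"
  shows "integrable lborel (\<lambda>u. indicator {0..} u * mexp M u $ i $ j)"
proof -
  obtain K \<alpha> where "\<alpha> > 0" and K: "\<And>t i j. t \<ge> 0 \<Longrightarrow> \<bar>mexp M t $ i $ j\<bar> \<le> K * exp (- (\<alpha> * t))"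
    using hurwitz_mexp_bound[OF assms] by metis
  \<comment> \<open>The majorant lives on the open half-line; the endpoint \<open>0\<close> is
    discarded below as a null set.\<close>
  have "integrable lborel (\<lambda>u. K * (indicator {0<..} u *\<^sub>R exp (- (u * \<alpha>))))"
    using integrable_I0i_exp_mscale[OF \<open>\<alpha> > 0\<close>] by (intro integrable_mult_right) (simp add: set_integrable_def)
  then show ?thesis
  proof (rule Bochner_Integration.integrable_bound)
    show "AE u in lborel. norm (indicator {0..} u * mexp M u $ i $ j)
        \<le> norm (K * (indicator {0<..} u *\<^sub>R exp (- (u * \<alpha>))))"
      using AE_lborel_singleton[of "0::real"]
    proof eventually_elim
      case (elim u)
      then show ?case
        using order_trans[OF K abs_ge_self, of u i j] by (auto simp: indicator_def mult.commute)
    qed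
  qed measurable
qed

lemma impulse_eq_sum:
  "impulse M B C i j u = (\<Sum>a\<in>UNIV. \<Sum>b\<in>UNIV. C $ i $ a * B $ b $ j * (indicator {0..} u * mexp M u $ a $ b))"
  unfolding impulse_def matrix_matrix_mult_def
  by (simp add: sum_distrib_left sum_distrib_right mult_ac) (intro impI, rule sum.swap)

lemma integrable_impulse:
  assumes "hurwitz M"
  shows "integrable lborel (impulse M B C i j)"
  unfolding impulse_eq_sum[abs_def]
  by (intro Bochner_Integration.integrable_sum integrable_mult_right integrable_mexp assms)

lemma mexp_tendsto_0:
  fixes M :: "real^'k^'k"
  assumes "hurwitz M"
  shows "((\<lambda>t. mexp M t $ i $ j) \<longlongrightarrow> 0) at_top"
proof -
  obtain K \<alpha> where "\<alpha> > 0" and K: "\<And>t i j. t \<ge> 0 \<Longrightarrow> \<bar>mexp M t $ i $ j\<bar> \<le> K * exp (- (\<alpha> * t))"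
    using hurwitz_mexp_bound[OF assms] by metis
  have "((\<lambda>t. K * exp (- (\<alpha> * t))) \<longlongrightarrow> 0) at_top"
    using \<open>\<alpha> > 0\<close> by real_asymp
  then show ?thesis
    by (rule Lim_null_comparison[rotated]) (use K in \<open>auto intro!: eventually_at_top_linorderI[of 0]\<close>)
qed

section \<open>Mean-square estimates for the output\<close>

lemma square_diff_sum_le:
  fixes a :: real and b :: "'m::finite \<Rightarrow> real"
  shows "(a - (\<Sum>k\<in>UNIV. b k))\<^sup>2 \<le> 2 * a\<^sup>2 + 2 * CARD('m) * (\<Sum>k\<in>UNIV. (b k)\<^sup>2)"
proof -
  have "(\<Sum>k\<in>UNIV. b k)\<^sup>2 \<le> CARD('m) * (\<Sum>k\<in>UNIV. (b k)\<^sup>2)"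
    using Cauchy_Schwarz_ineq_sum[of "\<lambda>_. 1" b UNIV] by simp
  moreover have "(a - (\<Sum>k\<in>UNIV. b k))\<^sup>2 \<le> 2 * a\<^sup>2 + 2 * (\<Sum>k\<in>UNIV. b k)\<^sup>2"
    using zero_le_power2[of "a + (\<Sum>k\<in>UNIV. b k)"] by (simp add: power2_sum power2_diff)
  ultimately show ?thesis by linarith
qed

text \<open>Applied twice below: to bound a functional of the state as output minus filters, and to
  bound the defect of the filter representation as initial-state term minus filter tails.\<close>

lemma second_moment_diff_sum_le:
  fixes a D :: "'a \<Rightarrow> real" and \<alpha> :: real and \<beta> :: "'m::finite \<Rightarrow> real" and b :: "'m::finite \<Rightarrow> 'a \<Rightarrow> real"
  assumes D: "D \<in> borel_measurable P" and eq: "AE p in P. D p = a p - (\<Sum>k\<in>UNIV. b k p)"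
    and a: "integrable P (\<lambda>p. (a p)\<^sup>2)" "(\<integral>p. (a p)\<^sup>2 \<partial>P) \<le> \<alpha>"
    and b: "\<And>k. integrable P (\<lambda>p. (b k p)\<^sup>2)" "\<And>k. (\<integral>p. (b k p)\<^sup>2 \<partial>P) \<le> \<beta> k"
  shows "integrable P (\<lambda>p. (D p)\<^sup>2)"
    and "(\<integral>p. (D p)\<^sup>2 \<partial>P) \<le> 2 * \<alpha> + 2 * CARD('m) * (\<Sum>k\<in>UNIV. \<beta> k)"
proof -
  note [measurable] = D
  have dom: "integrable P (\<lambda>p. 2 * (a p)\<^sup>2 + 2 * CARD('m) * (\<Sum>k\<in>UNIV. (b k p)\<^sup>2))"
    using a b by simp
  have le: "AE p in P. (D p)\<^sup>2 \<le> 2 * (a p)\<^sup>2 + 2 * CARD('m) * (\<Sum>k\<in>UNIV. (b k p)\<^sup>2)"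
    using eq by eventually_elim (simp only: square_diff_sum_le)
  show int: "integrable P (\<lambda>p. (D p)\<^sup>2)"
    by (rule Bochner_Integration.integrable_bound[OF dom])
      (use le in \<open>auto elim!: eventually_mono intro: order_trans[OF _ abs_ge_self]\<close>)
  have "(\<integral>p. (D p)\<^sup>2 \<partial>P) \<le> (\<integral>p. 2 * (a p)\<^sup>2 + 2 * CARD('m) * (\<Sum>k\<in>UNIV. (b k p)\<^sup>2) \<partial>P)"
    by (rule integral_mono_AE[OF int dom le])
  also have "\<dots> = 2 * (\<integral>p. (a p)\<^sup>2 \<partial>P) + 2 * CARD('m) * (\<Sum>k\<in>UNIV. \<integral>p. (b k p)\<^sup>2 \<partial>P)"
    using a b by simp
  also have "\<dots> \<le> 2 * \<alpha> + 2 * CARD('m) * (\<Sum>k\<in>UNIV. \<beta> k)"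
    using a b by (intro add_mono mult_left_mono sum_mono) auto
  finally show "(\<integral>p. (D p)\<^sup>2 \<partial>P) \<le> 2 * \<alpha> + 2 * CARD('m) * (\<Sum>k\<in>UNIV. \<beta> k)" .
qed

text \<open>The contribution of the initial state at time \<open>t - T\<close> vanishes in mean square as
  \<open>T \<rightarrow> \<infinity>\<close>, because it is a bounded functional of the state evaluated along the decaying
  rows of \<open>C exp(M T)\<close>.\<close>

lemma output_eq_filtered:
  fixes M :: "real^'k^'k" and B :: "real^'m^'k" and C :: "real^'k^'o"
    and w :: "real \<Rightarrow> 'a \<Rightarrow> real^'m" and x :: "real \<Rightarrow> 'a \<Rightarrow> real^'k" and y :: "real \<Rightarrow> 'a \<Rightarrow> real^'o"
  assumes P: "prob_space P" and "hurwitz M"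
    and x: "\<And>t. x t \<in> borel_measurable P"
    and w: "\<And>k. bounded_process P \<rho> (\<lambda>t p. w t p $ k)"
    and ode: "AE p in P. (\<forall>s t. s \<le> t \<longrightarrow>
      ((\<lambda>u. M *v x u p + B *v w u p) has_integral (x t p - x s p)) {s..t}) \<and> (\<forall>t. y t p = C *v x t p)"
    and y: "\<And>t. (\<lambda>p. y t p $ i) \<in> borel_measurable P" "\<And>t. integrable P (\<lambda>p. (y t p $ i)\<^sup>2)"
      "\<And>t. (\<integral>p. (y t p $ i)\<^sup>2 \<partial>P) \<le> \<rho>'"
  shows "AE p in P. y t p $ i = (\<Sum>k\<in>UNIV. filtered (impulse M B C i k) (\<lambda>t p. w t p $ k) t p)"
proof -
  note [measurable] = x y(1)
  let ?r = "\<lambda>T. (C $ i) v* mexp M T"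
  let ?w = "\<lambda>k t p. w t p $ k"
  define g where "g k = impulse M B C i k" for k
  \<comment> \<open>Variation of constants over \<open>{t - T..t}\<close> yields exactly the impulse
    response cut off at \<open>T\<close>.\<close>
  define gT where "gT T k u = indicator {..T} u * g k u" for T k u
  have g: "integrable lborel (g k)" for k
    unfolding g_def by (rule integrable_impulse[OF \<open>hurwitz M\<close>])
  have [measurable]: "g k \<in> borel_measurable borel" for k using g[of k] by auto
  have gT: "integrable lborel (gT T k)" for T k
    by (rule Bochner_Integration.integrable_bound[OF g[of k]]) (auto simp: gT_def[abs_def] indicator_def)
  have [measurable]: "gT T k \<in> borel_measurable borel" for T k using gT[of T k] by auto
  have path: "AE p in P. y t p $ i = ?r T \<bullet> x (t - T) p + (\<Sum>k\<in>UNIV. filtered (gT T k) (?w k) t p)"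
    if "T \<ge> 0" for T t
  proof -
    \<comment> \<open>Filtering with the indicator of the window shows that almost every noise path
      is Lebesgue integrable there, as variation of constants demands.\<close>
    have ind: "integrable lborel (indicator {0..T} :: real \<Rightarrow> real)"
      by (simp add: integrable_indicator_iff emeasure_lborel_Icc_eq)
    have "AE p in P. \<forall>k. integrable lborel (\<lambda>u. indicator {0..T} u * ?w k (t - u) p)"
      by (subst AE_all_countable) (intro allI filtered_AE_integrable[OF P w ind])
    moreover have "AE p in P. \<forall>k. integrable lborel (\<lambda>u. gT T k u * ?w k (t - u) p)"
      by (subst AE_all_countable) (intro allI filtered_AE_integrable[OF P w gT])
    ultimately show ?thesis using ode
    proof eventually_elim
      case (elim p)
      have row: "y t p $ i = (C $ i) \<bullet> x t p"
        using elim(3) by (simp add: matrix_vector_mul_component)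
      have "(C $ i) \<bullet> x t p = ?r T \<bullet> x (t - T) p
          + (LINT u:{0..T}|lborel. ?r u \<bullet> (B *v w (t - u) p))"
      proof (rule linear_ode_variation_of_constants[OF \<open>T \<ge> 0\<close>])
        show "((\<lambda>u. M *v x u p + B *v w u p) has_integral x t p - x s p) {s..t}" if "s \<le> t" for s t
          using elim(3) that by blast
        show "set_integrable lborel {0..T} (\<lambda>u. (B *v w (t - u) p) $ l)" for l
        proof -
          have "integrable lborel (\<lambda>u. \<Sum>k\<in>UNIV. B $ l $ k * (indicator {0..T} u * ?w k (t - u) p))"
            using elim(1) by (intro Bochner_Integration.integrable_sum integrable_mult_right) blast
          then show ?thesis
            by (simp add: set_integrable_def matrix_vector_mult_def scaleR_sum_right mult_ac sum_distrib_left)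
        qed
      qed
      also have "(LINT u:{0..T}|lborel. ?r u \<bullet> (B *v w (t - u) p))
          = (\<integral>u. (\<Sum>k\<in>UNIV. gT T k u * ?w k (t - u) p) \<partial>lborel)"
        unfolding set_lebesgue_integral_def
      proof (rule Bochner_Integration.integral_cong[OF refl])
        fix u
        have "?r u \<bullet> (B *v w (t - u) p) = (\<Sum>k\<in>UNIV. (C ** mexp M u ** B) $ i $ k * w (t - u) p $ k)"
        proof -
          have "?r u \<bullet> (B *v w (t - u) p) = (?r u v* B) \<bullet> w (t - u) p"
            by (simp add: dot_lmul_matrix)
          moreover have "(?r u v* B) $ k = (C ** mexp M u ** B) $ i $ k" for k
            unfolding vector_matrix_mul_assoc matrix_mul_assoc[symmetric]
            by (simp add: vector_matrix_mult_def matrix_matrix_mult_def mult.commute)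
          ultimately show ?thesis by (simp add: inner_vec_def)
        qed
        then show "indicator {0..T} u *\<^sub>R (?r u \<bullet> (B *v w (t - u) p))
            = (\<Sum>k\<in>UNIV. gT T k u * ?w k (t - u) p)"
          by (auto simp: gT_def g_def impulse_def indicator_def)
      qed
      also have "\<dots> = (\<Sum>k\<in>UNIV. filtered (gT T k) (?w k) t p)"
        unfolding filtered_def by (rule Bochner_Integration.integral_sum) (use elim(2) in blast)
      finally show ?case using row by simp
    qed
  qed
  obtain K where K: "\<And>T s. T \<ge> 0 \<Longrightarrow> integrable P (\<lambda>p. (?r T \<bullet> x s p)\<^sup>2)"
    "\<And>T s. T \<ge> 0 \<Longrightarrow> (\<integral>p. (?r T \<bullet> x s p)\<^sup>2 \<partial>P) \<le> K * (norm (?r T))\<^sup>2"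
  proof -
    obtain K where K: "\<And>v s. v \<in> {v. \<exists>K. \<forall>s. integrable P (\<lambda>p. (v \<bullet> x s p)\<^sup>2) \<and> (\<integral>p. (v \<bullet> x s p)\<^sup>2 \<partial>P) \<le> K}
        \<Longrightarrow> integrable P (\<lambda>p. (v \<bullet> x s p)\<^sup>2)"
      "\<And>v s. v \<in> {v. \<exists>K. \<forall>s. integrable P (\<lambda>p. (v \<bullet> x s p)\<^sup>2) \<and> (\<integral>p. (v \<bullet> x s p)\<^sup>2 \<partial>P) \<le> K}
        \<Longrightarrow> (\<integral>p. (v \<bullet> x s p)\<^sup>2 \<partial>P) \<le> K * (norm v)\<^sup>2"
      by (rule bounded_functionals_uniform[of x P, OF x]) blast
    \<comment> \<open>Read at time \<open>s + T\<close>, the path formula expresses this functional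
      of the state through the output and the noise, both with uniformly bounded second moments. So
      the row lies in the subspace to which the quadratic bound applies.\<close>
    have "\<exists>L. \<forall>s. integrable P (\<lambda>p. (?r T \<bullet> x s p)\<^sup>2) \<and> (\<integral>p. (?r T \<bullet> x s p)\<^sup>2 \<partial>P) \<le> L" if "T \<ge> 0" for T
    proof (intro exI allI conjI)
      fix s
      have eq: "AE p in P. ?r T \<bullet> x s p = y (s + T) p $ i - (\<Sum>k\<in>UNIV. filtered (gT T k) (?w k) (s + T) p)"
        using path[OF that, of "s + T"] by eventually_elim simp
      note bnd = second_moment_diff_sum_le[OF _ eq y(2) y(3) filtered_second_moment_le[OF P w gT]]
      show "integrable P (\<lambda>p. (?r T \<bullet> x s p)\<^sup>2)" by (rule bnd(1)) measurable
      show "(\<integral>p. (?r T \<bullet> x s p)\<^sup>2 \<partial>P)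
        \<le> 2 * \<rho>' + 2 * CARD('m) * (\<Sum>k\<in>UNIV. \<rho> * (\<integral>u. \<bar>gT T k u\<bar> \<partial>lborel)\<^sup>2)"
        by (rule bnd(2)) measurable
    qed
    then show thesis by (intro that[of K] K CollectI)
  qed
  \<comment> \<open>\<open>D\<close> does not involve \<open>T\<close>, while the bounds
    \<open>?e T\<close> on its second moment tend to zero: the row decays, and so do the L1 tails of
    the impulse responses.\<close>
  define D where "D p = y t p $ i - (\<Sum>k\<in>UNIV. filtered (g k) (?w k) t p)" for p
  have [measurable]: "filtered h (?w k) t \<in> borel_measurable P" if "integrable lborel h" for h k
    by (rule filtered_measurable[OF w that])
  have [measurable]: "D \<in> borel_measurable P"
    unfolding D_def[abs_def] using g by measurable
  have tail: "integrable lborel (\<lambda>u. g k u - gT T k u)" for k T using g gT by simp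
  let ?e = "\<lambda>T. 2 * (K * (norm (?r T))\<^sup>2)
    + 2 * CARD('m) * (\<Sum>k\<in>UNIV. \<rho> * (\<integral>u. \<bar>g k u - gT T k u\<bar> \<partial>lborel)\<^sup>2)"
  have D_le: "integrable P (\<lambda>p. (D p)\<^sup>2)" "(\<integral>p. (D p)\<^sup>2 \<partial>P) \<le> ?e T" if "T \<ge> 0" for T
  proof -
    have "AE p in P. \<forall>k. integrable lborel (\<lambda>u. g k u * ?w k (t - u) p)"
      by (subst AE_all_countable) (intro allI filtered_AE_integrable[OF P w g])
    moreover have "AE p in P. \<forall>k. integrable lborel (\<lambda>u. gT T k u * ?w k (t - u) p)"
      by (subst AE_all_countable) (intro allI filtered_AE_integrable[OF P w gT])
    ultimately have eq: "AE p in P. D p = ?r T \<bullet> x (t - T) p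
        - (\<Sum>k\<in>UNIV. filtered (\<lambda>u. g k u - gT T k u) (?w k) t p)"
      using path[OF that, of t]
      by eventually_elim
        (simp add: D_def filtered_def left_diff_distrib sum_subtractf)
    note bnd = second_moment_diff_sum_le[OF _ eq K[OF that] filtered_second_moment_le[OF P w tail]]
    show "integrable P (\<lambda>p. (D p)\<^sup>2)" "(\<integral>p. (D p)\<^sup>2 \<partial>P) \<le> ?e T"
      by (rule bnd; measurable)+
  qed
  have "((\<lambda>T. (?r T)) \<longlongrightarrow> 0) at_top"
    by (rule vec_tendstoI)
      (auto simp: vector_matrix_mult_def intro!: tendsto_null_sum tendsto_mult_right_zero mexp_tendsto_0[OF \<open>hurwitz M\<close>])
  then have "((\<lambda>T. norm (?r T)) \<longlongrightarrow> 0) at_top" by (rule tendsto_norm_zero)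
  moreover have "((\<lambda>T. \<integral>u. \<bar>g k u - gT T k u\<bar> \<partial>lborel) \<longlongrightarrow> (\<integral>u. 0 \<partial>(lborel :: real measure))) at_top" for k
  proof (rule integral_dominated_convergence_at_top[where w = "\<lambda>u. \<bar>g k u\<bar>"])
    show "AE u in lborel. ((\<lambda>T. \<bar>g k u - gT T k u\<bar>) \<longlongrightarrow> 0) at_top"
    proof (rule AE_I2, rule tendsto_eventually)
      fix u show "\<forall>\<^sub>F T in at_top. \<bar>g k u - gT T k u\<bar> = 0"
        by (rule eventually_at_top_linorderI[of u]) (simp add: gT_def)
    qed
  qed (use g in \<open>auto simp: gT_def indicator_def\<close>)
  then have "((\<lambda>T. \<integral>u. \<bar>g k u - gT T k u\<bar> \<partial>lborel) \<longlongrightarrow> 0) at_top" for k by simp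
  ultimately have "((\<lambda>T. ?e T) \<longlongrightarrow> 2 * (K * 0\<^sup>2) + 2 * CARD('m) * (\<Sum>k\<in>(UNIV :: 'm set). \<rho> * 0\<^sup>2)) at_top"
    by (intro tendsto_intros)
  then have "((\<lambda>T. ?e T) \<longlongrightarrow> 0) at_top" by simp
  then have "(\<integral>p. (D p)\<^sup>2 \<partial>P) \<le> 0"
    by (rule tendsto_lowerbound)
      (rule eventually_at_top_linorderI[of 0], erule D_le, simp)
  then have "(\<integral>p. (D p)\<^sup>2 \<partial>P) = 0" by (simp add: order_antisym)
  then have "AE p in P. (D p)\<^sup>2 = 0"
    using D_le(1)[of 0] by (subst integral_nonneg_eq_0_iff_AE[symmetric]) auto
  then show ?thesis
    by eventually_elim (simp add: D_def g_def)
qed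

subsection \<open>Fourier transforms of averaged translates\<close>

lemma ball_subset_interval_iff:
  fixes a b B :: real
  assumes "B > 0"
  shows "ball 0 B \<subseteq> {a..b} \<longleftrightarrow> a \<le> - B \<and> B \<le> b"
  using assms by (simp add: ball_eq_greaterThanLessThan greaterThanLessThan_subseteq_atLeastAtMost_iff)

lemma has_integral_UNIV_realD:
  fixes f :: "real \<Rightarrow> complex"
  assumes "(f has_integral I) UNIV" and "e > 0"
  obtains B where "B > 0" "\<And>a b. a \<le> - B \<Longrightarrow> B \<le> b \<Longrightarrow> norm (integral {a..b} f - I) < e"
proof -
  from assms obtain B where "B > 0"
    and B: "\<And>a b. ball 0 B \<subseteq> cbox a b \<Longrightarrow> \<exists>z. (f has_integral z) (cbox a b) \<and> norm (z - I) < e"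
    unfolding has_integral'[of f I UNIV] by auto
  show thesis
  proof (rule that[OF \<open>B > 0\<close>])
    fix a b assume "a \<le> - B" "B \<le> b"
    then have "ball 0 B \<subseteq> cbox a b" using \<open>B > 0\<close> by (simp add: ball_subset_interval_iff)
    from B[OF this] show "norm (integral {a..b} f - I) < e" by (auto simp: integral_unique)
  qed
qed

text \<open>The limit is phrased with sequences of endpoints, the form in which dominated
  convergence delivers it. If convergence failed, endpoints chosen for the radii
  \<open>Suc n\<close> would give a violating sequence.\<close>

lemma has_integral_UNIV_realI:
  fixes f :: "real \<Rightarrow> complex"
  assumes f: "\<And>a b. a \<le> b \<Longrightarrow> (f has_integral z a b) {a..b}"
    and lim: "\<And>a b. filterlim a at_bot sequentially \<Longrightarrow> filterlim b at_top sequentially \<Longrightarrow>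
      (\<And>n. a n \<le> b n) \<Longrightarrow> (\<lambda>n. z (a n) (b n)) \<longlonglongrightarrow> I"
  shows "(f has_integral I) UNIV"
proof (rule ccontr)
  assume "\<not> (f has_integral I) UNIV"
  then have "\<exists>e>0. \<forall>B>0. \<exists>a b. ball 0 B \<subseteq> cbox a b \<and>
      (\<forall>z. (f has_integral z) (cbox a b) \<longrightarrow> \<not> norm (z - I) < e)"
    unfolding has_integral'[of f I UNIV] by simp
  then obtain e where "e > 0" and e: "\<And>B. B > 0 \<Longrightarrow> \<exists>a b. ball 0 B \<subseteq> cbox a b \<and>
      (\<forall>z. (f has_integral z) (cbox a b) \<longrightarrow> norm (z - I) \<ge> e)"
    unfolding not_less by blast
  have "\<exists>a b. a \<le> - real (Suc n) \<and> real (Suc n) \<le> b \<and> norm (z a b - I) \<ge> e" for n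
  proof -
    obtain a b where "ball 0 (real (Suc n)) \<subseteq> cbox a b"
      and ab: "\<And>z. (f has_integral z) (cbox a b) \<Longrightarrow> norm (z - I) \<ge> e"
      using e[of "real (Suc n)"] by auto
    then have le: "a \<le> - real (Suc n)" "real (Suc n) \<le> b"
      using ball_subset_interval_iff[of "real (Suc n)" a b] by auto
    then have "a \<le> b" by linarith
    with f ab have "norm (z a b - I) \<ge> e" by simp
    with le show ?thesis by blast
  qed
  then obtain a b where a: "\<And>n. a n \<le> - real (Suc n)" and b: "\<And>n. real (Suc n) \<le> b n"
    and ge: "\<And>n. norm (z (a n) (b n) - I) \<ge> e" by metis
  have "filterlim (\<lambda>n. - real (Suc n)) at_bot sequentially" by real_asymp
  then have "filterlim a at_bot sequentially"
    by (rule filterlim_at_bot_mono) (use a in auto)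
  moreover have "filterlim (\<lambda>n. real (Suc n)) at_top sequentially" by real_asymp
  then have "filterlim b at_top sequentially"
    by (rule filterlim_at_top_mono) (use b in auto)
  moreover have "a n \<le> b n" for n using a[of n] b[of n] by linarith
  ultimately have "(\<lambda>n. z (a n) (b n)) \<longlonglongrightarrow> I" by (rule lim)
  then have "\<forall>\<^sub>F n in sequentially. dist (z (a n) (b n)) I < e"
    using \<open>e > 0\<close> by (rule tendstoD)
  with ge show False
    by (metis (no_types, lifting) dist_norm eventually_False eventually_mono not_less trivial_limit_sequentially)
qed

text \<open>Convergence controls only intervals that contain a large ball. Every other interval
  integral is a difference of two values of a primitive, so it suffices that this primitive is
  bounded.\<close>

lemma has_integral_UNIV_bounded_partial:
  fixes f :: "real \<Rightarrow> complex"
  assumes f: "(f has_integral I) UNIV" and C: "\<And>x. norm (f x) \<le> C"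
  obtains D where "\<And>a b. a \<le> b \<Longrightarrow> norm (integral {a..b} f) \<le> D"
proof -
  obtain B where "B > 0" and B: "\<And>a b. a \<le> - B \<Longrightarrow> B \<le> b \<Longrightarrow> norm (integral {a..b} f - I) < 1"
    using has_integral_UNIV_realD[OF f, of 1] by auto
  have int: "f integrable_on {a..b}" for a b
    using f integrable_on_subcbox[of f UNIV a b] by auto
  have "C \<ge> 0" using order_trans[OF norm_ge_zero C] .
  let ?J = "\<lambda>a b. integral {a..b} f"
  have far: "norm (?J a b) \<le> norm I + 1" if "a \<le> - B" "B \<le> b" for a b
    using B[OF that] norm_triangle_ineq2[of "?J a b" I] by linarith
  have near: "norm (?J a b) \<le> C * (2 * B)" if "- B \<le> a" "a \<le> b" "b \<le> B" for a b
  proof -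
    have "norm (?J a b) \<le> C * (b - a)"
      using integrable_bound[of C f a b] \<open>C \<ge> 0\<close> int[of a b] C that(2) by simp
    also have "\<dots> \<le> C * (2 * B)" using that \<open>C \<ge> 0\<close> by (intro mult_left_mono) auto
    finally show ?thesis .
  qed
  have prim: "\<exists>F. (\<forall>x. norm (F x) \<le> 2 * (norm I + 1) + C * (2 * B)) \<and> (\<forall>a b. a \<le> b \<longrightarrow> ?J a b = F b - F a)"
  proof (intro exI conjI allI impI)
    \<comment> \<open>The primitive that vanishes at \<open>- B\<close>. Outside the central
      interval it is estimated through intervals containing \<open>{- B..B}\<close>, inside it by
      length times \<open>C\<close>.\<close>
    let ?F = "\<lambda>x. if - B \<le> x then ?J (- B) x else - ?J x (- B)"
    fix x
    have "0 \<le> C * (2 * B)" "0 \<le> norm I" using \<open>C \<ge> 0\<close> \<open>B > 0\<close> by auto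
    moreover have "norm (?J x (- B)) \<le> 2 * (norm I + 1)" if "x < - B"
    proof -
      have "?J x (- B) = ?J x B - ?J (- B) B"
        using Henstock_Kurzweil_Integration.integral_combine[of x "- B" B f] that \<open>B > 0\<close> int by (simp add: algebra_simps)
      then show ?thesis
        using norm_triangle_ineq4[of "?J x B" "?J (- B) B"] far[of x B] far[of "- B" B] that by simp
    qed
    moreover have "norm (?J (- B) x) \<le> 2 * (norm I + 1) + C * (2 * B)" if "- B \<le> x"
    proof (cases "x \<le> B")
      case True
      have "norm (?J (- B) x) \<le> C * (2 * B)" by (rule near[OF order_refl that True])
      also have "\<dots> \<le> 2 * (norm I + 1) + C * (2 * B)" using \<open>0 \<le> norm I\<close> by simp
      finally show ?thesis .
    next
      case False
      then have "norm (?J (- B) x) \<le> norm I + 1" using far[of "- B" x] by simp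
      also have "\<dots> \<le> 2 * (norm I + 1) + C * (2 * B)" using \<open>0 \<le> norm I\<close> \<open>0 \<le> C * (2 * B)\<close> by simp
      finally show ?thesis .
    qed
    ultimately show "norm (?F x) \<le> 2 * (norm I + 1) + C * (2 * B)"
      by (auto simp: algebra_simps)
  next
    let ?F = "\<lambda>x. if - B \<le> x then ?J (- B) x else - ?J x (- B)"
    fix a b :: real assume "a \<le> b"
    note combine = Henstock_Kurzweil_Integration.integral_combine[OF _ _ int]
    show "?J a b = ?F b - ?F a"
      using \<open>a \<le> b\<close> combine[of "- B" a b] combine[of a "- B" b] combine[of a b "- B"]
      by (auto simp: algebra_simps)
  qed
  then obtain F where F: "\<And>x. norm (F x) \<le> 2 * (norm I + 1) + C * (2 * B)"
    "\<And>a b. a \<le> b \<Longrightarrow> ?J a b = F b - F a" by blast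
  show thesis
  proof (rule that)
    fix a b :: real assume "a \<le> b"
    then show "norm (?J a b) \<le> 2 * (2 * (norm I + 1) + C * (2 * B))"
      using F(2)[of a b] F(1)[of a] F(1)[of b] norm_triangle_ineq4[of "F b" "F a"] by simp
  qed
qed

lemma integrable_bounded_mult_pair:
  fixes g :: "'z \<Rightarrow> real" and k :: "'z \<Rightarrow> real \<Rightarrow> complex"
  assumes "sigma_finite_measure N" and g: "integrable N g"
    and k: "(\<lambda>(z, \<tau>). k z \<tau>) \<in> borel_measurable (N \<Otimes>\<^sub>M lborel)" and C: "\<And>z \<tau>. norm (k z \<tau>) \<le> C"
  shows "integrable (N \<Otimes>\<^sub>M lborel) (\<lambda>(z, \<tau>). of_real (g z * indicator {a..b} \<tau>) * k z \<tau>)"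
proof -
  have ind: "integrable lborel (\<lambda>\<tau>. C * indicator {a..b} \<tau> :: real)"
    by (simp add: integrable_indicator_iff emeasure_lborel_Icc_eq)
  have [measurable]: "g \<in> borel_measurable N" using g by auto
  note [measurable] = k
  show ?thesis
  proof (rule Bochner_Integration.integrable_bound[OF integrable_pair_mult[OF assms(1) sigma_finite_lborel g ind]])
    have "norm (k z \<tau>) \<le> \<bar>C\<bar>" for z \<tau> using C[of z \<tau>] by linarith
    then show "AE p in N \<Otimes>\<^sub>M lborel. norm (case p of (z, \<tau>) \<Rightarrow> of_real (g z * indicator {a..b} \<tau>) * k z \<tau>)
        \<le> norm (case p of (z, \<tau>) \<Rightarrow> g z * (C * indicator {a..b} \<tau>))"
      by (auto simp: norm_mult abs_mult indicator_def intro!: AE_I2 mult_left_mono)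
  qed (simp add: split_beta')
qed

text \<open>The Fourier integral of \<open>R\<close> may converge only conditionally; its partial integrals
  are nevertheless uniformly bounded, which is what dominated convergence needs.\<close>

lemma has_integral_fourier_average:
  fixes R :: "real \<Rightarrow> real" and g \<rho> :: "'z \<Rightarrow> real" and S :: complex
  assumes N: "sigma_finite_measure N" and g: "integrable N g" and \<rho>: "\<rho> \<in> borel_measurable N"
    and R: "R \<in> borel_measurable borel" and C: "\<And>\<tau>. \<bar>R \<tau>\<bar> \<le> C"
    and S: "((\<lambda>\<tau>. of_real (R \<tau>) * exp (- (\<i> * of_real \<omega> * of_real \<tau>))) has_integral S) UNIV"
  shows "((\<lambda>\<tau>. of_real (\<integral>z. g z * R (\<tau> + \<rho> z) \<partial>N) * exp (- (\<i> * of_real \<omega> * of_real \<tau>)))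
    has_integral (\<integral>z. of_real (g z) * exp (\<i> * of_real \<omega> * of_real (\<rho> z)) \<partial>N) * S) UNIV"
proof -
  interpret pair_sigma_finite N lborel by (intro pair_sigma_finite.intro N sigma_finite_lborel)
  have [measurable]: "g \<in> borel_measurable N" using g by auto
  note [measurable] = \<rho> R
  let ?e = "\<lambda>\<tau>. exp (- (\<i> * of_real \<omega> * of_real \<tau>)) :: complex"
  let ?E = "\<lambda>\<sigma>. of_real (R \<sigma>) * ?e \<sigma>"
  let ?k = "\<lambda>z \<tau>. of_real (R (\<tau> + \<rho> z)) * ?e \<tau>"
  have E_le: "norm (?E \<sigma>) \<le> C" for \<sigma> using C[of \<sigma>] by (simp add: norm_mult norm_exp_eq_Re)
  have k_le: "norm (?k z \<tau>) \<le> C" for z \<tau> using C[of "\<tau> + \<rho> z"] by (simp add: norm_mult norm_exp_eq_Re)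
  \<comment> \<open>A translate of \<open>R\<close> contributes a phase and a shifted window; the
    phase survives in the limit, the shift does not.\<close>
  have shift: "(\<lambda>\<tau>. ?k z \<tau>) = (\<lambda>\<tau>. exp (\<i> * of_real \<omega> * of_real (\<rho> z)) * ?E (\<tau> + \<rho> z))" for z
    by (auto simp: fun_eq_iff algebra_simps exp_add[symmetric])
  obtain D where D: "\<And>a b. a \<le> b \<Longrightarrow> norm (integral {a..b} ?E) \<le> D"
    by (rule has_integral_UNIV_bounded_partial[OF S E_le]) blast
  define J where "J a b z = (LINT \<tau>:{a..b}|lborel. ?k z \<tau>)" for a b z
  have J_eq: "J a b z = exp (\<i> * of_real \<omega> * of_real (\<rho> z)) * integral {a + \<rho> z..b + \<rho> z} ?E" if "z \<in> space N" for a b z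
  proof -
    have "set_integrable lborel {a..b} (?k z)"
      unfolding set_integrable_def
    proof (rule Bochner_Integration.integrable_bound)
      show "integrable lborel (\<lambda>\<tau>. C * indicator {a..b} \<tau> :: real)"
        by (simp add: integrable_indicator_iff emeasure_lborel_Icc_eq)
    qed (use order_trans[OF k_le abs_ge_self] in \<open>auto simp: indicator_def\<close>)
    then have "J a b z = integral {a..b} (?k z)"
      unfolding J_def by (rule set_borel_integral_eq_integral(2))
    also have "\<dots> = exp (\<i> * of_real \<omega> * of_real (\<rho> z)) * integral {a..b} (\<lambda>\<tau>. ?E (\<tau> + \<rho> z))"
      unfolding shift by (rule integral_mult_right)
    also have "integral {a..b} (\<lambda>\<tau>. ?E (\<tau> + \<rho> z)) = integral {a + \<rho> z..b + \<rho> z} ?E"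
    proof -
      have "?E integrable_on {a + \<rho> z..b + \<rho> z}"
        using integrable_on_subcbox[of ?E UNIV "a + \<rho> z" "b + \<rho> z"] S by auto
      from has_integral_shift_real_ivl[OF integrable_integral[OF this], of "\<rho> z"]
      show ?thesis by (simp add: integral_unique)
    qed
    finally show ?thesis .
  qed
  have int: "integrable (N \<Otimes>\<^sub>M lborel) (\<lambda>(z, \<tau>). of_real (g z * indicator {a..b} \<tau>) * ?k z \<tau>)" for a b
    by (rule integrable_bounded_mult_pair[OF N g _ k_le]) (simp add: split_beta')
  have inner: "(\<integral>\<tau>. of_real (g z * indicator {a..b} \<tau>) * ?k z \<tau> \<partial>lborel) = of_real (g z) * J a b z" for a b z
    unfolding J_def set_lebesgue_integral_def
    by (subst integral_mult_right_zero[symmetric]) (simp add: scaleR_conv_of_real mult_ac)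
  have outer: "(\<integral>z. of_real (g z * indicator {a..b} \<tau>) * ?k z \<tau> \<partial>N)
      = indicator {a..b} \<tau> *\<^sub>R (of_real (\<integral>z. g z * R (\<tau> + \<rho> z) \<partial>N) * ?e \<tau>)" for a b \<tau>
  proof -
    have "(\<integral>z. of_real (g z * indicator {a..b} \<tau>) * ?k z \<tau> \<partial>N)
        = (\<integral>z. of_real (g z * R (\<tau> + \<rho> z)) * (indicator {a..b} \<tau> *\<^sub>R ?e \<tau>) \<partial>N)"
      by (simp add: scaleR_conv_of_real mult_ac)
    also have "\<dots> = (\<integral>z. of_real (g z * R (\<tau> + \<rho> z)) \<partial>N) * (indicator {a..b} \<tau> *\<^sub>R ?e \<tau>)"
      by (rule integral_mult_left_zero)
    finally show ?thesis by (simp only: integral_complex_of_real[of N "\<lambda>z. g z * R (\<tau> + \<rho> z)"]) (simp add: scaleR_conv_of_real mult_ac)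
  qed
  \<comment> \<open>Fubini is legitimate on each finite window. As the windows exhaust the line,
    \<open>\<bar>g z\<bar> * D\<close> dominates, with \<open>D\<close> the uniform bound on the
    partial integrals.\<close>
  show ?thesis
  proof (rule has_integral_UNIV_realI[where z = "\<lambda>a b. \<integral>z. of_real (g z) * J a b z \<partial>N"])
    fix a b :: real
    have "set_integrable lborel {a..b} (\<lambda>\<tau>. of_real (\<integral>z. g z * R (\<tau> + \<rho> z) \<partial>N) * ?e \<tau>)"
      using integrable_snd[OF int[of a b]] unfolding outer by (simp add: set_integrable_def)
    note * = set_borel_integral_eq_integral[OF this]
    have "(LINT \<tau>:{a..b}|lborel. of_real (\<integral>z. g z * R (\<tau> + \<rho> z) \<partial>N) * ?e \<tau>)
        = (\<integral>z. of_real (g z) * J a b z \<partial>N)"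
      using Fubini_integral[OF int[of a b]] unfolding outer inner by (simp add: set_lebesgue_integral_def)
    with * show "((\<lambda>\<tau>. of_real (\<integral>z. g z * R (\<tau> + \<rho> z) \<partial>N) * ?e \<tau>)
        has_integral (\<integral>z. of_real (g z) * J a b z \<partial>N)) {a..b}"
      by (simp add: has_integral_iff)
  next
    fix a b :: "nat \<Rightarrow> real"
    assume a: "filterlim a at_bot sequentially" and b: "filterlim b at_top sequentially"
      and ab: "\<And>n. a n \<le> b n"
    have "(\<lambda>n. \<integral>z. of_real (g z) * J (a n) (b n) z \<partial>N)
        \<longlonglongrightarrow> (\<integral>z. of_real (g z) * exp (\<i> * of_real \<omega> * of_real (\<rho> z)) * S \<partial>N)"
    proof (rule integral_dominated_convergence[where w = "\<lambda>z. \<bar>g z\<bar> * D"])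
      show "(\<lambda>z. of_real (g z) * J (a n) (b n) z) \<in> borel_measurable N" for n
        using integrable_fst[OF int[of "a n" "b n"]] unfolding inner by auto
      show "AE z in N. (\<lambda>n. of_real (g z) * J (a n) (b n) z)
          \<longlonglongrightarrow> of_real (g z) * exp (\<i> * of_real \<omega> * of_real (\<rho> z)) * S"
      proof (rule AE_I2)
        fix z assume z: "z \<in> space N"
        have "(\<lambda>n. integral {a n + \<rho> z..b n + \<rho> z} ?E) \<longlonglongrightarrow> S"
        proof (rule tendstoI)
          fix e :: real assume "e > 0"
          then obtain B where B: "\<And>a b. a \<le> - B \<Longrightarrow> B \<le> b \<Longrightarrow> norm (integral {a..b} ?E - S) < e"
            using has_integral_UNIV_realD[OF S] by metis
          have "\<forall>\<^sub>F n in sequentially. a n \<le> - B - \<rho> z"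
            using a unfolding filterlim_at_bot by blast
          moreover have "\<forall>\<^sub>F n in sequentially. b n \<ge> B - \<rho> z"
            using b unfolding filterlim_at_top by blast
          ultimately show "\<forall>\<^sub>F n in sequentially. dist (integral {a n + \<rho> z..b n + \<rho> z} ?E) S < e"
            by eventually_elim (auto simp: dist_norm intro!: B)
        qed
        then show "(\<lambda>n. of_real (g z) * J (a n) (b n) z)
            \<longlonglongrightarrow> of_real (g z) * exp (\<i> * of_real \<omega> * of_real (\<rho> z)) * S"
          unfolding J_eq[OF z] mult.assoc by (intro tendsto_intros)
      qed
      show "AE z in N. norm (of_real (g z) * J (a n) (b n) z) \<le> \<bar>g z\<bar> * D" for n
        using D ab by (intro AE_I2) (auto simp: J_eq norm_mult norm_exp_eq_Re intro!: mult_left_mono)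
    qed (use g in auto)
    then show "(\<lambda>n. \<integral>z. of_real (g z) * J (a n) (b n) z \<partial>N)
        \<longlonglongrightarrow> (\<integral>z. of_real (g z) * exp (\<i> * of_real \<omega> * of_real (\<rho> z)) \<partial>N) * S"
      by simp
  qed
qed

subsection \<open>The frequency response\<close>

lemma matrix_inv_eqI:
  fixes S Z :: "'a::field^'n^'n"
  assumes "S ** Z = mat 1"
  shows "matrix_inv S = Z"
proof -
  have "Z ** S = mat 1" using assms by (simp add: matrix_left_right_inverse)
  with assms have "invertible S" unfolding invertible_def by blast
  then have "matrix_inv S ** S = mat 1"
    using someI_ex[of "\<lambda>A'. S ** A' = mat 1 \<and> A' ** S = mat 1"]
    by (auto simp: invertible_def matrix_inv_def)
  then have "matrix_inv S ** (S ** Z) = Z" by (simp add: matrix_mul_assoc)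
  with assms show ?thesis by simp
qed

text \<open>Here \<open>S = s H H\<^sup>*\<close>. Taking adjoints in \<open>Q ** H = mat 1\<close>
  shows that \<open>Q\<^sup>* / s\<close> inverts \<open>s H\<^sup>*\<close>, whence the inverse
  \<open>Q\<^sup>* Q / s\<close>.\<close>

lemma matrix_inv_gram:
  fixes Q H :: "complex^'m^'m" and s :: real
  assumes QH: "Q ** H = mat 1" and "s \<noteq> 0"
    and S: "\<And>i j. S $ i $ j = (\<Sum>k\<in>UNIV. H $ i $ k * cnj (H $ j $ k) * of_real s)"
  shows "matrix_inv S $ i $ j = (\<Sum>k\<in>UNIV. cnj (Q $ k $ i) * Q $ k $ j) / of_real s"
proof -
  define K where "K = (\<chi> i j. of_real s * cnj (H $ j $ i))"
  define K' where "K' = (\<chi> i j. cnj (Q $ j $ i) / of_real s)"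
  have HQ: "H ** Q = mat 1" using QH by (simp add: matrix_left_right_inverse)
  have S_eq: "S = H ** K"
    by (simp add: vec_eq_iff S K_def matrix_matrix_mult_def mult_ac)
  have "K ** K' = mat 1"
  proof -
    have "(K ** K') $ i $ j = cnj ((Q ** H) $ j $ i)" for i j
      using \<open>s \<noteq> 0\<close> by (simp add: K_def K'_def matrix_matrix_mult_def mult_ac)
    then show ?thesis unfolding QH by (auto simp: vec_eq_iff mat_def)
  qed
  then have "S ** (K' ** Q) = mat 1"
    unfolding S_eq by (metis HQ matrix_mul_assoc matrix_mul_rid)
  then have "matrix_inv S = K' ** Q" by (rule matrix_inv_eqI)
  then show ?thesis
    by (simp add: K'_def matrix_matrix_mult_def sum_divide_distrib)
qed

text \<open>The Laplace transform of the exponential on the imaginary axis, that is, the resolvent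
  of a Hurwitz \<open>M\<close> at \<open>\<i> * \<omega>\<close>.\<close>

definition mexp_laplace :: "real^'k^'k \<Rightarrow> real \<Rightarrow> complex^'k^'k" where
  "mexp_laplace M \<omega> = (\<chi> a b. \<integral>u. of_real (indicator {0..} u * mexp M u $ a $ b)
     * exp (- (\<i> * of_real \<omega> * of_real u)) \<partial>lborel)"

lemma integrable_mult_exp:
  assumes "integrable lborel g"
  shows "integrable lborel (\<lambda>u. of_real (g u) * exp (- (\<i> * of_real \<omega> * of_real u)))"
proof (rule Bochner_Integration.integrable_bound[OF assms])
  have [measurable]: "g \<in> borel_measurable borel" using assms by auto
  show "(\<lambda>u. of_real (g u) * exp (- (\<i> * of_real \<omega> * of_real u))) \<in> borel_measurable lborel" by measurable
qed (simp add: norm_mult norm_exp_eq_Re)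

text \<open>Integrate the derivative of \<open>mexp M u\<close> times the oscillating factor over
  the half-line: the boundary term at infinity vanishes by decay, and the one at \<open>0\<close> is
  minus the identity.\<close>

lemma resolvent_mexp_laplace:
  fixes M :: "real^'k^'k"
  assumes "hurwitz M"
  shows "\<i> * of_real \<omega> * mexp_laplace M \<omega> $ a $ b
    - (\<Sum>d\<in>UNIV. of_real (M $ a $ d) * mexp_laplace M \<omega> $ d $ b) = (if a = b then 1 else 0)"
proof -
  let ?e = "\<lambda>u. exp (- (\<i> * of_real \<omega> * of_real u)) :: complex"
  let ?F = "\<lambda>u. of_real (mexp M u $ a $ b) * ?e u"
  let ?h = "\<lambda>a b u. of_real (indicator {0..} u * mexp M u $ a $ b) * ?e u"
  define f where "f u = (\<Sum>d\<in>UNIV. of_real (M $ a $ d) * (of_real (mexp M u $ d $ b) * ?e u)) - \<i> * of_real \<omega> * ?F u" for u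
  have h: "integrable lborel (?h a b)" for a b
    by (rule integrable_mult_exp[OF integrable_mexp[OF assms]])
  have ind: "indicator {0..} u *\<^sub>R f u = (\<Sum>d\<in>UNIV. of_real (M $ a $ d) * ?h d b u) - \<i> * of_real \<omega> * ?h a b u" for u
    by (auto simp: f_def indicator_def)
  have f_int: "set_integrable lborel {0..} f"
    unfolding set_integrable_def ind
    by (intro Bochner_Integration.integrable_diff Bochner_Integration.integrable_sum integrable_mult_right h)
  have "(LINT u:{0..}|lborel. f u) = (\<Sum>d\<in>UNIV. of_real (M $ a $ d) * mexp_laplace M \<omega> $ d $ b)
      - \<i> * of_real \<omega> * mexp_laplace M \<omega> $ a $ b"
    unfolding set_lebesgue_integral_def ind
    by (subst Bochner_Integration.integral_diff)
      (auto simp: mexp_laplace_def h intro!: Bochner_Integration.integrable_sum integrable_mult_right h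
        simp del: of_real_mult)
  moreover have "((\<lambda>T. LINT u:{0..T}|lborel. f u) \<longlongrightarrow> (LINT u:{0..}|lborel. f u)) at_top"
    by (rule tendsto_set_lebesgue_integral_at_top[OF _ f_int]) simp
  moreover have "((\<lambda>T. LINT u:{0..T}|lborel. f u) \<longlongrightarrow> - (if a = b then 1 else 0)) at_top"
  proof -
    have deriv: "(?F has_vector_derivative f u) (at u)" for u
    proof -
      have "((\<lambda>u. of_real (mexp M u $ a $ b)) has_vector_derivative of_real ((M ** mexp M u) $ a $ b)) (at u)"
        by (rule has_vector_derivative_of_real)
          (simp add: mexp_deriv_left has_real_derivative_iff_has_vector_derivative[symmetric])
      moreover have "(?e has_vector_derivative ?e u * (- (\<i> * of_real \<omega>))) (at u)"
        by (rule has_vector_derivative_real_field) (auto intro!: derivative_eq_intros)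
      ultimately have "(?F has_vector_derivative
          of_real (mexp M u $ a $ b) * (?e u * (- (\<i> * of_real \<omega>))) + of_real ((M ** mexp M u) $ a $ b) * ?e u) (at u)"
        by (rule has_vector_derivative_mult)
      moreover have "of_real (mexp M u $ a $ b) * (?e u * (- (\<i> * of_real \<omega>))) + of_real ((M ** mexp M u) $ a $ b) * ?e u = f u"
        by (simp add: f_def matrix_matrix_mult_def sum_distrib_right mult.assoc)
      ultimately show ?thesis by simp
    qed
    have FTC: "(LINT u:{0..T}|lborel. f u) = ?F T - ?F 0" if "T \<ge> 0" for T
    proof -
      have "set_integrable lborel {0..T} f" by (rule set_integrable_subset[OF f_int]) auto
      moreover have "(f has_integral ?F T - ?F 0) {0..T}"
        using that by (intro fundamental_theorem_of_calculus) (auto intro: has_vector_derivative_at_within deriv)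
      ultimately show ?thesis
        by (simp only: set_borel_integral_eq_integral(2) integral_unique)
    qed
    have "((\<lambda>T. norm (?F T)) \<longlongrightarrow> 0) at_top"
      using tendsto_norm_zero[OF mexp_tendsto_0[OF assms, of a b]] by (simp add: norm_mult norm_exp_eq_Re)
    then have "((\<lambda>T. ?F T) \<longlongrightarrow> 0) at_top" by (rule tendsto_norm_zero_cancel)
    then have "((\<lambda>T. ?F T - ?F 0) \<longlongrightarrow> 0 - ?F 0) at_top" by (intro tendsto_intros)
    moreover have "\<forall>\<^sub>F T in at_top. ?F T - ?F 0 = (LINT u:{0..T}|lborel. f u)"
      using FTC by (intro eventually_at_top_linorderI[of 0]) simp
    ultimately have "((\<lambda>T. LINT u:{0..T}|lborel. f u) \<longlongrightarrow> 0 - ?F 0) at_top"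
      by (rule Lim_transform_eventually)
    then show ?thesis by (cases "a = b") (simp_all add: mat_def)
  qed
  ultimately have "(\<Sum>d\<in>UNIV. of_real (M $ a $ d) * mexp_laplace M \<omega> $ d $ b)
      - \<i> * of_real \<omega> * mexp_laplace M \<omega> $ a $ b = - (if a = b then 1 else 0)"
    using tendsto_unique[of at_top] by (metis trivial_limit_at_top_linorder)
  then show ?thesis by (simp add: algebra_simps split: if_splits)
qed

text \<open>The transfer matrix \<open>C (\<i> \<omega> - M)\<^sup>-\<^sup>1 B\<close>, kept as a
  Fourier integral because output spectra produce it in that form.\<close>

definition freq_response :: "real^'k^'k \<Rightarrow> real^'m^'k \<Rightarrow> real^'k^'o \<Rightarrow> real \<Rightarrow> complex^'m^'o" where
  "freq_response M B C \<omega> = (\<chi> i j. \<integral>u. of_real (impulse M B C i j u)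
     * exp (- (\<i> * of_real \<omega> * of_real u)) \<partial>lborel)"

lemma freq_response_eq_sum:
  fixes M :: "real^'k^'k"
  assumes "hurwitz M"
  shows "freq_response M B C \<omega> $ i $ j
    = (\<Sum>a\<in>UNIV. of_real (C $ i $ a) * (\<Sum>b\<in>UNIV. mexp_laplace M \<omega> $ a $ b * of_real (B $ b $ j)))"
proof -
  let ?e = "\<lambda>u. exp (- (\<i> * of_real \<omega> * of_real u)) :: complex"
  let ?h = "\<lambda>a b u. of_real (indicator {0..} u * mexp M u $ a $ b) * ?e u"
  have h: "integrable lborel (?h a b)" for a b
    by (rule integrable_mult_exp[OF integrable_mexp[OF assms]])
  have "of_real (impulse M B C i j u) * ?e u
      = (\<Sum>a\<in>UNIV. \<Sum>b\<in>UNIV. of_real (C $ i $ a * B $ b $ j) * ?h a b u)" for u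
    by (simp add: impulse_eq_sum sum_distrib_left sum_distrib_right mult_ac)
  then have "freq_response M B C \<omega> $ i $ j
      = (\<integral>u. (\<Sum>a\<in>UNIV. \<Sum>b\<in>UNIV. of_real (C $ i $ a * B $ b $ j) * ?h a b u) \<partial>lborel)"
    by (simp add: freq_response_def)
  also have "\<dots> = (\<Sum>a\<in>UNIV. \<Sum>b\<in>UNIV. of_real (C $ i $ a * B $ b $ j) * mexp_laplace M \<omega> $ a $ b)"
    unfolding mexp_laplace_def vec_lambda_beta
    by (subst Bochner_Integration.integral_sum, intro Bochner_Integration.integrable_sum integrable_mult_right h,
        intro sum.cong refl, subst Bochner_Integration.integral_sum, intro integrable_mult_right h,
        intro sum.cong refl integral_mult_right_zero)
  also have "\<dots> = (\<Sum>a\<in>UNIV. of_real (C $ i $ a) * (\<Sum>b\<in>UNIV. mexp_laplace M \<omega> $ a $ b * of_real (B $ b $ j)))"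
    by (simp add: sum_distrib_left mult_ac)
  finally show ?thesis .
qed

lemma sum_UNIV_prod:
  fixes f :: "'m::finite \<times> 'n::finite \<Rightarrow> 'c::comm_monoid_add"
  shows "(\<Sum>z\<in>UNIV. f z) = (\<Sum>j\<in>UNIV. \<Sum>\<beta>\<in>UNIV. f (j, \<beta>))"
  unfolding UNIV_Times_UNIV[symmetric] by (simp add: sum.cartesian_product)

text \<open>The nodes are decoupled by regarding the interconnection as an input: node \<open>i\<close> is driven
  by \<open>\<delta>\<^sub>i\<^sub>k + \<Sum>\<^sub>j g\<^sub>i\<^sub>j H\<^sub>j\<^sub>k\<close>.\<close>

lemma network_freq_response_fixpoint:
  fixes A :: "real^'n^'n" and b c :: "real^'n" and G :: "real^'m^'m"
  assumes "hurwitz (system_matrix A b c G)"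
    and inv: "invertible (mat (\<i> * of_real \<omega>) - map_matrix complex_of_real A)"
  defines "H \<equiv> freq_response (system_matrix A b c G) (kron_col (mat 1) b) (kron_row (mat 1) c) \<omega>"
  shows "H $ i $ k = nodal_transfer A b c (\<i> * of_real \<omega>)
    * ((if i = k then 1 else 0) + (\<Sum>j\<in>UNIV. of_real (G $ i $ j) * H $ j $ k))"
proof -
  let ?M = "system_matrix A b c G"
  let ?B = "kron_col (mat 1) b :: real^'m^('m \<times> 'n)"
  let ?D = "mat (\<i> * of_real \<omega>) - map_matrix complex_of_real A"
  let ?b = "\<chi> l. complex_of_real (b $ l)"
  define L where "L = mexp_laplace ?M \<omega>"
  \<comment> \<open>Column \<open>k\<close> of the resolvent times the input matrix: the state
    response to a unit input at node \<open>k\<close>.\<close>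
  define X where "X z = (\<Sum>z'\<in>UNIV. L $ z $ z' * of_real (?B $ z' $ k))" for z
  have H_eq: "H $ j $ k = (\<Sum>\<beta>\<in>UNIV. of_real (c $ \<beta>) * X (j, \<beta>))" for j
  proof -
    have "H $ j $ k = (\<Sum>z\<in>UNIV. of_real (kron_row (mat 1) c $ j $ z) * X z)"
      unfolding H_def X_def L_def by (rule freq_response_eq_sum[OF assms(1)])
    also have "\<dots> = (\<Sum>l\<in>UNIV. \<Sum>\<beta>\<in>UNIV. if j = l then of_real (c $ \<beta>) * X (l, \<beta>) else 0)"
      by (auto simp: sum_UNIV_prod kron_row_def mat_def intro!: sum.cong)
    also have "\<dots> = (\<Sum>\<beta>\<in>UNIV. of_real (c $ \<beta>) * X (j, \<beta>))"
      by (subst sum.swap) simp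
    finally show ?thesis .
  qed
  \<comment> \<open>The total scalar input of node \<open>i\<close>, external plus received from
    other nodes. Block \<open>i\<close> of the resolvent equation then involves \<open>A\<close>
    alone.\<close>
  define r where "r = (if i = k then 1 else 0) + (\<Sum>j\<in>UNIV. of_real (G $ i $ j) * H $ j $ k)"
  have "?D *v (\<chi> \<alpha>. X (i, \<alpha>)) = r *s ?b"
  proof (rule vec_eq_iff[THEN iffD2], rule allI)
    fix \<alpha>
    have "\<i> * of_real \<omega> * X (i, \<alpha>) - (\<Sum>z\<in>UNIV. of_real (?M $ (i, \<alpha>) $ z) * X z)
        = (\<Sum>z'\<in>UNIV. (\<i> * of_real \<omega> * L $ (i, \<alpha>) $ z'
            - (\<Sum>z\<in>UNIV. of_real (?M $ (i, \<alpha>) $ z) * L $ z $ z')) * of_real (?B $ z' $ k))"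
    proof -
      have "(\<Sum>z\<in>UNIV. of_real (?M $ (i, \<alpha>) $ z) * X z)
          = (\<Sum>z'\<in>UNIV. (\<Sum>z\<in>UNIV. of_real (?M $ (i, \<alpha>) $ z) * L $ z $ z') * of_real (?B $ z' $ k))"
        unfolding X_def sum_distrib_left sum_distrib_right mult.assoc by (rule sum.swap)
      then show ?thesis
        by (simp add: X_def sum_distrib_left left_diff_distrib sum_subtractf mult.assoc)
    qed
    also have "\<dots> = (\<Sum>z'\<in>UNIV. (if (i, \<alpha>) = z' then 1 else 0) * of_real (?B $ z' $ k))"
      unfolding L_def by (simp only: resolvent_mexp_laplace[OF assms(1)])
    also have "\<dots> = of_real (?B $ (i, \<alpha>) $ k)"
      by (simp add: if_distrib if_distribR cong: if_cong)
    finally have res: "\<i> * of_real \<omega> * X (i, \<alpha>) - (\<Sum>z\<in>UNIV. of_real (?M $ (i, \<alpha>) $ z) * X z)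
      = (if i = k then of_real (b $ \<alpha>) else 0)"
      by (simp add: kron_col_def mat_def)
    have "(\<Sum>z\<in>UNIV. of_real (?M $ (i, \<alpha>) $ z) * X z)
        = (\<Sum>j\<in>UNIV. \<Sum>\<beta>\<in>UNIV. (if i = j then of_real (A $ \<alpha> $ \<beta>) * X (j, \<beta>) else 0)
            + of_real (G $ i $ j) * (of_real (b $ \<alpha>) * (of_real (c $ \<beta>) * X (j, \<beta>))))"
      by (auto simp: sum_UNIV_prod system_matrix_def kron_def mat_def matrix_matrix_mult_def
          columnvector_def rowvector_def algebra_simps intro!: sum.cong)
    also have "\<dots> = (\<Sum>j\<in>UNIV. \<Sum>\<beta>\<in>UNIV. if i = j then of_real (A $ \<alpha> $ \<beta>) * X (j, \<beta>) else 0)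
        + (\<Sum>j\<in>UNIV. of_real (G $ i $ j) * (of_real (b $ \<alpha>) * H $ j $ k))"
      by (simp add: sum.distrib H_eq sum_distrib_left)
    also have "(\<Sum>j\<in>UNIV. \<Sum>\<beta>\<in>UNIV. if i = j then of_real (A $ \<alpha> $ \<beta>) * X (j, \<beta>) else 0)
        = (\<Sum>\<beta>\<in>UNIV. of_real (A $ \<alpha> $ \<beta>) * X (i, \<beta>))"
      by (subst sum.swap) simp
    finally have "\<i> * of_real \<omega> * X (i, \<alpha>) - (\<Sum>\<beta>\<in>UNIV. of_real (A $ \<alpha> $ \<beta>) * X (i, \<beta>))
        = r * of_real (b $ \<alpha>)"
      using res by (simp add: r_def algebra_simps sum_distrib_left sum_distrib_right split: if_splits)
    moreover have "(?D *v (\<chi> \<alpha>. X (i, \<alpha>))) $ \<alpha>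
        = \<i> * of_real \<omega> * X (i, \<alpha>) - (\<Sum>\<beta>\<in>UNIV. of_real (A $ \<alpha> $ \<beta>) * X (i, \<beta>))"
      by (simp add: matrix_vector_mult_diff_rdistrib)
        (simp add: matrix_vector_mult_def mat_def if_distribR if_distrib cong: if_cong)
    ultimately show "(?D *v (\<chi> \<alpha>. X (i, \<alpha>))) $ \<alpha> = (r *s ?b) $ \<alpha>" by simp
  qed
  then have "matrix_inv ?D *v (?D *v (\<chi> \<alpha>. X (i, \<alpha>))) = r *s (matrix_inv ?D *v ?b)"
    by (simp add: vector_scalar_commute)
  moreover have "matrix_inv ?D ** ?D = mat 1"
    using inv someI_ex[of "\<lambda>A'. ?D ** A' = mat 1 \<and> A' ** ?D = mat 1"]
    by (auto simp: invertible_def matrix_inv_def)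
  ultimately have "(\<chi> \<alpha>. X (i, \<alpha>)) = r *s (matrix_inv ?D *v ?b)"
    by (simp add: matrix_vector_mul_assoc)
  then have "X (i, \<alpha>) = r * (matrix_inv ?D *v ?b) $ \<alpha>" for \<alpha>
    by (metis vec_lambda_beta vector_smult_component)
  then show ?thesis
    unfolding H_eq[of i] nodal_transfer_def r_def[symmetric] by (simp add: sum_distrib_left sum_distrib_right mult_ac)
qed

subsection \<open>Power spectral densities\<close>

text \<open>The trace is the sum of the nonnegative products of opposite entries, so each product
  vanishes.\<close>

lemma trace_square_eq_0_nonreciprocal:
  fixes G :: "real^'m^'m"
  assumes nonneg: "\<And>i j. G $ i $ j \<ge> 0" and "trace (G ** G) = 0"
  shows "G $ i $ j = 0 \<or> G $ j $ i = 0"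
proof -
  have "(\<Sum>i\<in>UNIV. \<Sum>j\<in>UNIV. G $ i $ j * G $ j $ i) = 0"
    using assms(2) by (simp add: trace_def matrix_matrix_mult_def)
  then have "G $ i $ j * G $ j $ i = 0"
    using nonneg by (subst (asm) sum_nonneg_eq_0_iff; (subst (asm) sum_nonneg_eq_0_iff)?) (auto intro!: sum_nonneg)
  then show ?thesis by simp
qed

text \<open>Expanding both outputs, only equal noise components correlate. The lag is the difference
  of the delayed times, \<open>(0 - u) - (- \<tau> - v) = \<tau> + (v - u)\<close>.\<close>

lemma output_cross_correlation:
  fixes w y :: "real \<Rightarrow> 'a \<Rightarrow> real^'m" and g :: "'m \<Rightarrow> 'm \<Rightarrow> real \<Rightarrow> real"
  assumes P: "prob_space P"
    and w: "\<And>k. bounded_process P \<rho> (\<lambda>t p. w t p $ k)"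
    and R: "\<And>k s t. (\<integral>p. w s p $ k * w t p $ k \<partial>P) = R (s - t)"
    and uncorr: "\<And>k l s t. k \<noteq> l \<Longrightarrow> (\<integral>p. w s p $ k * w t p $ l \<partial>P) = 0"
    and g: "\<And>i k. integrable lborel (g i k)"
    and y: "\<And>i t. (\<lambda>p. y t p $ i) \<in> borel_measurable P"
      "\<And>i t. AE p in P. y t p $ i = (\<Sum>k\<in>UNIV. filtered (g i k) (\<lambda>t p. w t p $ k) t p)"
  shows "cross_correlation P (\<lambda>t p. y t p $ i) (\<lambda>t p. y t p $ j) \<tau>
    = (\<Sum>k\<in>UNIV. \<integral>z. g i k (fst z) * g j k (snd z) * R (\<tau> + (snd z - fst z)) \<partial>(lborel \<Otimes>\<^sub>M lborel))"
proof -
  let ?w = "\<lambda>k t p. w t p $ k"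
  have [measurable]: "filtered (g i k) (?w k) t \<in> borel_measurable P" for i k t
    by (rule filtered_measurable[OF w g])
  note [measurable] = y(1)
  note cov = filtered_covariance[OF P w w g g]
  have "cross_correlation P (\<lambda>t p. y t p $ i) (\<lambda>t p. y t p $ j) \<tau>
      = (\<integral>p. (\<Sum>k\<in>UNIV. filtered (g i k) (?w k) 0 p) * (\<Sum>l\<in>UNIV. filtered (g j l) (?w l) (0 - \<tau>) p) \<partial>P)"
    unfolding cross_correlation_def
    by (rule integral_cong_AE) (use y(2)[of 0 i] y(2)[of "0 - \<tau>" j] in auto)
  also have "\<dots> = (\<Sum>k\<in>UNIV. \<Sum>l\<in>UNIV. \<integral>p. filtered (g i k) (?w k) 0 p * filtered (g j l) (?w l) (0 - \<tau>) p \<partial>P)"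
    unfolding sum_product
    by (subst Bochner_Integration.integral_sum, intro Bochner_Integration.integrable_sum cov(1),
        intro sum.cong refl Bochner_Integration.integral_sum cov(1))
  also have "\<dots> = (\<Sum>k\<in>UNIV. \<Sum>l\<in>UNIV. if k = l then
      \<integral>z. g i k (fst z) * g j k (snd z) * R (\<tau> + (snd z - fst z)) \<partial>(lborel \<Otimes>\<^sub>M lborel) else 0)"
  proof (intro sum.cong refl)
    fix k l
    show "(\<integral>p. filtered (g i k) (?w k) 0 p * filtered (g j l) (?w l) (0 - \<tau>) p \<partial>P)
      = (if k = l then \<integral>z. g i k (fst z) * g j k (snd z) * R (\<tau> + (snd z - fst z)) \<partial>(lborel \<Otimes>\<^sub>M lborel) else 0)"
      unfolding cov(2) by (auto simp: R uncorr split_beta' algebra_simps)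
  qed
  finally show ?thesis by simp
qed

lemma cross_psd_filtered:
  fixes g :: "'o \<Rightarrow> 'm::finite \<Rightarrow> real \<Rightarrow> real" and R Ry :: "real \<Rightarrow> real"
  assumes g: "\<And>i k. integrable lborel (g i k)"
    and R: "R \<in> borel_measurable borel" "\<And>\<tau>. \<bar>R \<tau>\<bar> \<le> C" and "fourier_transform R \<omega> \<noteq> 0"
    and Ry: "\<And>\<tau>. Ry \<tau> = (\<Sum>k\<in>UNIV. \<integral>z. g i k (fst z) * g j k (snd z) * R (\<tau> + (snd z - fst z)) \<partial>(lborel \<Otimes>\<^sub>M lborel))"
  defines "H \<equiv> \<lambda>i k. \<integral>u. of_real (g i k u) * exp (- (\<i> * of_real \<omega> * of_real u)) \<partial>lborel"
  shows "fourier_transform Ry \<omega> = (\<Sum>k\<in>UNIV. H i k * cnj (H j k) * fourier_transform R \<omega>)"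
proof -
  let ?N = "lborel \<Otimes>\<^sub>M lborel :: (real \<times> real) measure"
  let ?e = "\<lambda>\<tau>. exp (- (\<i> * of_real \<omega> * of_real \<tau>)) :: complex"
  \<comment> \<open>A divergent Fourier integral would have the default value \<open>0\<close>, so
    the nonzero spectral density certifies convergence.\<close>
  have "(\<lambda>\<tau>. of_real (R \<tau>) * ?e \<tau>) integrable_on UNIV"
    using assms(4) not_integrable_integral unfolding fourier_transform_def by blast
  then have S: "((\<lambda>\<tau>. of_real (R \<tau>) * ?e \<tau>) has_integral fourier_transform R \<omega>) UNIV"
    unfolding fourier_transform_def by (rule integrable_integral)
  have G: "integrable ?N (\<lambda>z. g i k (fst z) * g j k (snd z))" for k
    using integrable_pair_mult[OF sigma_finite_lborel sigma_finite_lborel g[of i k] g[of j k]]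
    by (simp add: split_beta')
  \<comment> \<open>The phase of the lag \<open>v - u\<close> factors; its \<open>v\<close> part has
    the opposite sign, which is the source of the conjugate.\<close>
  have eq: "(\<integral>z. of_real (g i k (fst z) * g j k (snd z)) * exp (\<i> * of_real \<omega> * of_real (snd z - fst z)) \<partial>?N)
      = H i k * cnj (H j k)" for k
  proof -
    have "integrable lborel (\<lambda>v. cnj (of_real (g j k v) * ?e v))"
      by (rule integrable_cnj[OF integrable_mult_exp[OF g]])
    note prod = integrable_pair_mult[OF sigma_finite_lborel sigma_finite_lborel
        integrable_mult_exp[OF g[of i k], of \<omega>] this]
    have "(\<integral>z. of_real (g i k (fst z) * g j k (snd z)) * exp (\<i> * of_real \<omega> * of_real (snd z - fst z)) \<partial>?N)
        = (\<integral>(u, v). (of_real (g i k u) * ?e u) * cnj (of_real (g j k v) * ?e v) \<partial>?N)"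
      by (intro Bochner_Integration.integral_cong refl)
        (auto simp: split_beta' exp_add[symmetric] exp_cnj algebra_simps)
    also have "\<dots> = (\<integral>u. \<integral>v. (of_real (g i k u) * ?e u) * cnj (of_real (g j k v) * ?e v) \<partial>lborel \<partial>lborel)"
      by (rule lborel_pair.integral_fst[symmetric, OF prod])
    also have "\<dots> = H i k * cnj (H j k)"
      by (simp only: H_def integral_mult_right_zero integral_mult_left_zero Bochner_Integration.integral_cnj)
    finally show ?thesis .
  qed
  have "((\<lambda>\<tau>. of_real (\<integral>z. g i k (fst z) * g j k (snd z) * R (\<tau> + (snd z - fst z)) \<partial>?N) * ?e \<tau>)
      has_integral H i k * cnj (H j k) * fourier_transform R \<omega>) UNIV" for k
    unfolding eq[symmetric]
    by (rule has_integral_fourier_average[OF lborel_pair.sigma_finite_measure_axioms G _ R S]) measurable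
  then have "((\<lambda>\<tau>. \<Sum>k\<in>UNIV. of_real (\<integral>z. g i k (fst z) * g j k (snd z) * R (\<tau> + (snd z - fst z)) \<partial>?N) * ?e \<tau>)
      has_integral (\<Sum>k\<in>UNIV. H i k * cnj (H j k) * fourier_transform R \<omega>)) UNIV"
    by (intro has_integral_sum) auto
  then show ?thesis
    unfolding fourier_transform_def Ry of_real_sum sum_distrib_right by (rule integral_unique)
qed

section \<open>Recovery of the connectivity matrix\<close>

theorem theorem11:
  fixes P :: "'a measure"
    and A :: "real^'n^'n" and b c :: "real^'n" and G :: "real^'m^'m"
    and w y :: "real \<Rightarrow> 'a \<Rightarrow> real^'m"
    and x :: "real \<Rightarrow> 'a \<Rightarrow> real^('m \<times> 'n)"
    and S\<^sub>w :: "real \<Rightarrow> real" and \<Omega> :: real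
  assumes "prob_space P"
    and "\<And>t. x t \<in> borel_measurable P"
    and "(\<lambda>(t, p). w t p) \<in> borel_measurable (borel \<Otimes>\<^sub>M P)"
    and "network_solution P A b c G w x y"
    and "\<And>i j. G $ i $ j \<ge> 0"
    and "trace (G ** G) = 0"
    and "hurwitz (system_matrix A b c G)"
    and "\<And>i. wide_sense_stationary P (\<lambda>t p. w t p $ i)"
    and "\<And>i t. (\<integral>p. w t p $ i \<partial>P) = 0"
    and "\<And>i j. i \<noteq> j \<Longrightarrow> uncorrelated_processes P (\<lambda>t p. w t p $ i) (\<lambda>t p. w t p $ j)"
    and "\<And>i j \<tau>. cross_correlation P (\<lambda>t p. w t p $ i) (\<lambda>t p. w t p $ i) \<tau> =
                  cross_correlation P (\<lambda>t p. w t p $ j) (\<lambda>t p. w t p $ j) \<tau>"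
    and "\<And>i \<omega>. cross_psd P (\<lambda>t p. w t p $ i) (\<lambda>t p. w t p $ i) \<omega> = complex_of_real (S\<^sub>w \<omega>)"
    and "\<Omega> > 0"
    and "\<And>\<omega>. \<omega> \<in> {-\<Omega><..<\<Omega>} \<Longrightarrow> S\<^sub>w \<omega> > 0"
    and "\<And>i j. jointly_wide_sense_stationary P (\<lambda>t p. y t p $ i) (\<lambda>t p. y t p $ j)"
  shows "\<forall>\<omega> \<in> {-\<Omega><..<\<Omega>}.
           invertible (mat (\<i> * complex_of_real \<omega>) - map_matrix complex_of_real A) \<longrightarrow>
           Im (inverse (nodal_transfer A b c (\<i> * complex_of_real \<omega>))) \<noteq> 0 \<longrightarrow>
           (\<forall>i j. i \<noteq> j \<longrightarrow>
              G $ i $ j =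
                max (S\<^sub>w \<omega> * (Im (matrix_inv (cross_psd_matrix P y \<omega>) $ i $ j) /
                             Im (inverse (nodal_transfer A b c (\<i> * complex_of_real \<omega>))))) 0)"
proof (intro ballI impI allI)
  fix \<omega> and i j :: 'm
  assume \<omega>: "\<omega> \<in> {-\<Omega><..<\<Omega>}"
    and inv: "invertible (mat (\<i> * complex_of_real \<omega>) - map_matrix complex_of_real A)"
    and Im_q: "Im (inverse (nodal_transfer A b c (\<i> * complex_of_real \<omega>))) \<noteq> 0"
    and "i \<noteq> j"
  let ?M = "system_matrix A b c G"
  let ?B = "kron_col (mat 1) b :: real^'m^('m \<times> 'n)"
  let ?C = "kron_row (mat 1) c :: real^('m \<times> 'n)^'m"
  define R where "R = cross_correlation P (\<lambda>t p. w t p $ i) (\<lambda>t p. w t p $ i)"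
  have R_eq: "(\<integral>p. w s p $ k * w t p $ k \<partial>P) = R (s - t)" for k s t
  proof -
    have "(\<integral>p. w s p $ k * w (s - (s - t)) p $ k \<partial>P)
        = cross_correlation P (\<lambda>t p. w t p $ k) (\<lambda>t p. w t p $ k) (s - t)"
      using assms(8)[of k] unfolding wide_sense_stationary_def by blast
    then show ?thesis using assms(11)[of k "s - t" i] by (simp add: R_def)
  qed
  have w: "bounded_process P (R 0) (\<lambda>t p. w t p $ k)" for k
  proof -
    have "(\<lambda>(t, p). w t p $ k) \<in> borel_measurable (borel \<Otimes>\<^sub>M P)"
      using measurable_compose[OF assms(3), of "\<lambda>v. v $ k"] by (simp add: split_beta')
    moreover have "integrable P (\<lambda>p. (w t p $ k)\<^sup>2)" for t
      using assms(8)[of k] by (simp add: wide_sense_stationary_def second_order_process_def)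
    moreover have "(\<integral>p. (w t p $ k)\<^sup>2 \<partial>P) \<le> R 0" for t
      using R_eq[of t k t] by (simp add: power2_eq_square)
    ultimately show ?thesis by (simp add: bounded_process_def)
  qed
  have uncorr: "(\<integral>p. w s p $ k * w t p $ l \<partial>P) = 0" if "k \<noteq> l" for k l s t
    using assms(10)[OF that] assms(9) by (simp add: uncorrelated_processes_def)
  have y: "wide_sense_stationary P (\<lambda>t p. y t p $ l)" for l
    using assms(15)[of l l] by (simp add: jointly_wide_sense_stationary_def)
  have y_meas: "(\<lambda>p. y t p $ l) \<in> borel_measurable P" and y_int: "integrable P (\<lambda>p. (y t p $ l)\<^sup>2)" for t l
    using y[of l] by (auto simp: wide_sense_stationary_def second_order_process_def)
  have y_bound: "(\<integral>p. (y t p $ l)\<^sup>2 \<partial>P) \<le> cross_correlation P (\<lambda>t p. y t p $ l) (\<lambda>t p. y t p $ l) 0" for t l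
  proof -
    have "(\<integral>p. y t p $ l * y (t - 0) p $ l \<partial>P) = cross_correlation P (\<lambda>t p. y t p $ l) (\<lambda>t p. y t p $ l) 0"
      using y[of l] unfolding wide_sense_stationary_def by blast
    then show ?thesis by (simp add: power2_eq_square)
  qed
  have y_eq: "AE p in P. y t p $ l = (\<Sum>k\<in>UNIV. filtered (impulse ?M ?B ?C l k) (\<lambda>t p. w t p $ k) t p)" for t l
    by (rule output_eq_filtered[OF assms(1,7,2) w assms(4)[unfolded network_solution_def] y_meas y_int y_bound])
  note g = integrable_impulse[OF assms(7)]
  have R_meas: "R \<in> borel_measurable borel"
  proof -
    interpret prob_space P by (rule assms(1))
    have [measurable]: "(\<lambda>z. w 0 (snd z) $ i) \<in> borel_measurable (borel \<Otimes>\<^sub>M P)"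
      "(\<lambda>z. w (0 - fst z) (snd z) $ i) \<in> borel_measurable (borel \<Otimes>\<^sub>M P)"
      by (rule bounded_process_measurable[OF w]; measurable)+
    have "(\<lambda>(\<tau>, p). w 0 p $ i * w (0 - \<tau>) p $ i) \<in> borel_measurable (borel \<Otimes>\<^sub>M P)"
      unfolding split_beta' by measurable
    then show ?thesis
      unfolding R_def cross_correlation_def[abs_def] by (rule borel_measurable_lebesgue_integral)
  qed
  have R_bound: "\<bar>R \<tau>\<bar> \<le> R 0" for \<tau>
    using order_trans[OF integral_abs_bound bounded_process_mult(2)[OF w[of i] w[of i], of 0 "- \<tau>"]]
    by (simp add: R_eq)
  define s where "s = S\<^sub>w \<omega>"
  have "s > 0" unfolding s_def by (rule assms(14)[OF \<omega>])
  have psd: "fourier_transform R \<omega> = of_real s"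
    using assms(12)[of i \<omega>] by (simp add: R_def s_def cross_psd_def)
  define H where "H = freq_response ?M ?B ?C \<omega>"
  have S: "cross_psd_matrix P y \<omega> $ k $ l = (\<Sum>d\<in>UNIV. H $ k $ d * cnj (H $ l $ d) * of_real s)" for k l
  proof -
    have corr: "cross_correlation P (\<lambda>t p. y t p $ k) (\<lambda>t p. y t p $ l) \<tau>
        = (\<Sum>d\<in>UNIV. \<integral>z. impulse ?M ?B ?C k d (fst z) * impulse ?M ?B ?C l d (snd z)
            * R (\<tau> + (snd z - fst z)) \<partial>(lborel \<Otimes>\<^sub>M lborel))" for \<tau>
      by (rule output_cross_correlation[OF assms(1) w R_eq _ g y_meas y_eq]) (rule uncorr)
    have "fourier_transform R \<omega> \<noteq> 0" using psd \<open>s > 0\<close> by simp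
    note cross_psd_filtered[where g = "impulse ?M ?B ?C", OF g R_meas R_bound this corr]
    then show ?thesis by (simp add: cross_psd_matrix_def cross_psd_def psd H_def freq_response_def)
  qed
  define q where "q = inverse (nodal_transfer A b c (\<i> * complex_of_real \<omega>))"
  define Q where "Q = mat q - map_matrix complex_of_real G"
  have "Im q \<noteq> 0" using Im_q by (simp add: q_def)
  \<comment> \<open>Since \<open>inverse 0 = 0\<close> is real, a zero transfer function would
    contradict the nonzero imaginary part.\<close>
  have "nodal_transfer A b c (\<i> * complex_of_real \<omega>) \<noteq> 0" using Im_q by auto
  have "Q ** H = mat 1"
  proof -
    have "(Q ** H) $ k $ l = q * H $ k $ l - (\<Sum>d\<in>UNIV. of_real (G $ k $ d) * H $ d $ l)" for k l
      by (simp add: Q_def matrix_matrix_mult_def left_diff_distrib sum_subtractf)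
        (simp add: mat_def if_distribR if_distrib cong: if_cong)
    moreover have "q * H $ k $ l = (if k = l then 1 else 0) + (\<Sum>d\<in>UNIV. of_real (G $ k $ d) * H $ d $ l)" for k l
      using network_freq_response_fixpoint[OF assms(7) inv, of k l] \<open>nodal_transfer A b c _ \<noteq> 0\<close>
      by (simp add: H_def q_def)
    ultimately show ?thesis by (simp add: vec_eq_iff mat_def)
  qed
  then have "matrix_inv (cross_psd_matrix P y \<omega>) $ i $ j = (\<Sum>k\<in>UNIV. cnj (Q $ k $ i) * Q $ k $ j) / of_real s"
    using \<open>s > 0\<close> S by (intro matrix_inv_gram) auto
  \<comment> \<open>\<open>Q\<close> has nonreal entries only on its diagonal, so only the summands
    \<open>k = i\<close> and \<open>k = j\<close> contribute.\<close>
  moreover have "Im (\<Sum>k\<in>UNIV. cnj (Q $ k $ i) * Q $ k $ j) = Im q * (G $ i $ j - G $ j $ i)"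
  proof -
    have "Im (cnj (Q $ k $ i) * Q $ k $ j)
        = (if k = i then Im q * G $ i $ j else 0) - (if k = j then Im q * G $ j $ i else 0)" for k
      using \<open>i \<noteq> j\<close> by (auto simp: Q_def mat_def)
    then show ?thesis by (simp add: sum_subtractf right_diff_distrib)
  qed
  ultimately have "s * (Im (matrix_inv (cross_psd_matrix P y \<omega>) $ i $ j) / Im q) = G $ i $ j - G $ j $ i"
    using \<open>s > 0\<close> \<open>Im q \<noteq> 0\<close> by simp
  \<comment> \<open>At most one of the two opposite entries is nonzero and both are nonnegative, so
    the positive part of their difference is \<open>G $ i $ j\<close>.\<close>
  then show "G $ i $ j = max (S\<^sub>w \<omega> * (Im (matrix_inv (cross_psd_matrix P y \<omega>) $ i $ j) /
      Im (inverse (nodal_transfer A b c (\<i> * complex_of_real \<omega>))))) 0"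
    using trace_square_eq_0_nonreciprocal[OF assms(5,6), of i j] assms(5)[of i j] assms(5)[of j i]
    unfolding s_def[symmetric] q_def[symmetric] by (auto simp: max_def)
qed

end
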